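(* Let $F$ be a formal group law over a commutative ring $R$ such that $[n]_F(t)\in R[[t]]$ is not a zero-divisor for any $n>0$. Consider the function $F\log(x)=\frac{t}{\ell_F(t)}\log(x)\in(R\otimes\mathbf{Q})[[t,x-1]]$. Then: (1) $\nabla_F(F\log(x))=\frac1x$. (2) $F\log(xy)=F\log(x)+F\log(y)$. (3) There is a series expansion $$F\log(x)=\sum_{n\ge 1}\frac{\langle -n+1\rangle_F\cdots\langle -1\rangle_F}{n!_F}\,(x-1)^n_s .$$
   Context: A (one-dimensional) formal group law over $R$ is $F(x,y)=x+_Fy\in R[[x,y]]$ with $F(F(x,y),z)=F(x,F(y,z))$ and $F(x,y)\equiv x+y\pmod{(x,y)^2}$. $[n]_F(t)=t+_F\cdots+_Ft$ ($n$ times) for $n\ge 0$, extended to all $n\in\mathbf{Z}$ using inverses for the formal group law; $\langle n\rangle_F=[n]_F(t)/t$; $n!_F=\prod_{i=1}^n\langle i\rangle_F$. The logarithm is $\ell_F(x)=\int_0^x\frac{du}{(\partial_yF)(u,0)}\in(R\otimes\mathbf{Q})[[x]]$ and $\mathcal{E}_F$ is its compositional inverse. $\log(x)=\sum_{n\ge 1}(-1)^{n+1}(x-1)^n/n$. The $F$-derivative $\nabla_F$ is the $R[[t]]$-linear operator on $R[[t]][x]$ with $x^n\mapsto\langle n\rangle_Fx^{n-1}$; over $R\otimes\mathbf{Q}$ it equals $\frac{1}{tx}\mathcal{E}_F(\ell_F(t)\,x\partial_x)$, and this formula extends it to $(R\otimes\mathbf{Q})[[t,x-1]]$. For $s(n)=\langle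 n\rangle_F$, $(x+y)^n_s$ denotes the unique sequence of polynomials in $x,y$ (with coefficients in $R[[t]]$ with all $\langle i\rangle_F$, $i\ge1$, inverted) such that $(x+y)^0_s=1$; $(x+y)^n_s$ becomes $0$ upon substituting $y=-x$ for $n>0$; and the $F$-derivative with respect to $x$ (linear in $y$) of $(x+y)^n_s$ is $\langle n\rangle_F(x+y)^{n-1}_s$ for $n>0$. $(x-1)^n_s$ is its value at $y=-1$. *)

theory Defs
  imports
    "HOL-Computational_Algebra.Formal_Power_Series"
    "HOL-Computational_Algebra.Polynomial"
begin

unbundle fps_syntax

section \<open>Commutative rings in which 0 = 1 is allowed\<close>

text \<open>
  If \<open>R\<close> is torsion (e.g. of characteristic \<open>p\<close>), the ring \<open>R \<otimes> \<rat>\<close> is trivial, so as a type it is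
  not an instance of \<^class>\<open>comm_ring_1\<close>, which demands \<open>0 \<noteq> 1\<close>. It is an instance of
  \<^class>\<open>comm_ring\<close> and \<^class>\<open>comm_monoid_mult\<close>. The library provides the multiplicative monoid
  structure on power series only over \<^class>\<open>semiring_1\<close>; the arities are generalised here.
\<close>

instance fps :: ("{semiring_0, monoid_mult}") monoid_mult
proof
  fix a :: "'a fps"
  show "1 * a = a"
    by (rule fps_ext) (simp add: fps_mult_nth fps_one_def if_distrib[of "\<lambda>x. x * _"] sum.delta cong: if_cong)
  show "a * 1 = a"
  proof (rule fps_ext)
    fix n
    have "(a * 1) $ n = (\<Sum>i=0..n. if i = n then a $ n else 0)"
      unfolding fps_mult_nth by (rule sum.cong) (auto simp: fps_one_def)
    also have "\<dots> = a $ n" by simp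
    finally show "(a * 1) $ n = a $ n" .
  qed
qed

instance fps :: ("{comm_semiring_0, comm_monoid_mult}") comm_monoid_mult
  by standard simp

definition unit_inv :: "'b::{comm_ring, comm_monoid_mult} \<Rightarrow> 'b" where
  "unit_inv a = (THE b. a * b = 1)"


section \<open>Localisation\<close>

text \<open>Equality of the fractions \<open>a/s\<close> and \<open>b/t\<close> in \<open>S\<inverse>A\<close>.\<close>

definition loc_rel :: "'b::comm_ring_1 set \<Rightarrow> 'b \<times> 'b \<Rightarrow> 'b \<times> 'b \<Rightarrow> bool" where
  "loc_rel S p q \<longleftrightarrow> snd p \<in> S \<and> snd q \<in> S \<and>
     (\<exists>u\<in>S. u * (fst p * snd q - fst q * snd p) = 0)"

definition submonoid :: "'b::comm_ring_1 set \<Rightarrow> bool" where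
  "submonoid S \<longleftrightarrow> 1 \<in> S \<and> (\<forall>a\<in>S. \<forall>b\<in>S. a * b \<in> S)"

lemma loc_rel_refl: "submonoid S \<Longrightarrow> snd p \<in> S \<Longrightarrow> loc_rel S p p"
  by (auto simp: loc_rel_def submonoid_def)

lemma loc_rel_sym: "loc_rel S p q \<Longrightarrow> loc_rel S q p"
proof -
  assume "loc_rel S p q"
  then obtain u where u: "u \<in> S" "u * (fst p * snd q - fst q * snd p) = 0"
    and s: "snd p \<in> S" "snd q \<in> S"
    by (auto simp: loc_rel_def)
  have "u * (fst q * snd p - fst p * snd q) = - (u * (fst p * snd q - fst q * snd p))"
    by (simp add: algebra_simps)
  then have "u * (fst q * snd p - fst p * snd q) = 0" using u(2) by simp
  then show ?thesis using u(1) s unfolding loc_rel_def by blast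
qed

lemma loc_rel_trans:
  assumes S: "submonoid S" and "loc_rel S p q" "loc_rel S q r"
  shows "loc_rel S p r"
proof -
  from assms obtain u v where u: "u \<in> S" "u * (fst p * snd q - fst q * snd p) = 0"
    and v: "v \<in> S" "v * (fst q * snd r - fst r * snd q) = 0"
    and s: "snd p \<in> S" "snd q \<in> S" "snd r \<in> S"
    by (auto simp: loc_rel_def)
  have "(u * v * snd q) * (fst p * snd r - fst r * snd p) =
      v * snd r * (u * (fst p * snd q - fst q * snd p)) +
      u * snd p * (v * (fst q * snd r - fst r * snd q))"
    by (simp add: algebra_simps)
  also have "\<dots> = 0" using u v by simp
  finally have "(u * v * snd q) * (fst p * snd r - fst r * snd p) = 0" .
  moreover have "u * v * snd q \<in> S" using S u v s by (auto simp: submonoid_def)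
  ultimately show ?thesis using s unfolding loc_rel_def by blast
qed

lemma part_equivp_loc_rel:
  assumes "submonoid S" shows "part_equivp (loc_rel S)"
proof (rule part_equivpI)
  show "\<exists>x. loc_rel S x x"
    using loc_rel_refl[OF assms, of "(0, 1)"] assms by (auto simp: submonoid_def)
  show "symp (loc_rel S)" by (rule sympI) (rule loc_rel_sym)
  show "transp (loc_rel S)" by (rule transpI) (rule loc_rel_trans[OF assms])
qed

definition frac_add :: "'b::comm_ring_1 \<times> 'b \<Rightarrow> 'b \<times> 'b \<Rightarrow> 'b \<times> 'b" where
  "frac_add p q = (fst p * snd q + fst q * snd p, snd p * snd q)"

definition frac_mult :: "'b::comm_ring_1 \<times> 'b \<Rightarrow> 'b \<times> 'b \<Rightarrow> 'b \<times> 'b" where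
  "frac_mult p q = (fst p * fst q, snd p * snd q)"

definition frac_uminus :: "'b::comm_ring_1 \<times> 'b \<Rightarrow> 'b \<times> 'b" where
  "frac_uminus p = (- fst p, snd p)"

lemma loc_rel_add:
  assumes S: "submonoid S" and "loc_rel S p p'" "loc_rel S q q'"
  shows "loc_rel S (frac_add p q) (frac_add p' q')"
proof -
  from assms obtain u v where u: "u \<in> S" "u * (fst p * snd p' - fst p' * snd p) = 0"
    and v: "v \<in> S" "v * (fst q * snd q' - fst q' * snd q) = 0"
    and s: "snd p \<in> S" "snd q \<in> S" "snd p' \<in> S" "snd q' \<in> S"
    by (auto simp: loc_rel_def)
  have "(u * v) * ((fst p * snd q + fst q * snd p) * (snd p' * snd q') -
        (fst p' * snd q' + fst q' * snd p') * (snd p * snd q)) =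
      v * snd q * snd q' * (u * (fst p * snd p' - fst p' * snd p)) +
      u * snd p * snd p' * (v * (fst q * snd q' - fst q' * snd q))"
    by (simp add: algebra_simps)
  also have "\<dots> = 0" using u v by simp
  finally have "(u * v) * ((fst p * snd q + fst q * snd p) * (snd p' * snd q') -
        (fst p' * snd q' + fst q' * snd p') * (snd p * snd q)) = 0" .
  moreover have "u * v \<in> S" using S u v by (auto simp: submonoid_def)
  ultimately show ?thesis
    using s S unfolding loc_rel_def frac_add_def submonoid_def by (auto intro!: bexI[of _ "u * v"])
qed

lemma loc_rel_mult:
  assumes S: "submonoid S" and "loc_rel S p p'" "loc_rel S q q'"
  shows "loc_rel S (frac_mult p q) (frac_mult p' q')"
proof -
  from assms obtain u v where u: "u \<in> S" "u * (fst p * snd p' - fst p' * snd p) = 0"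
    and v: "v \<in> S" "v * (fst q * snd q' - fst q' * snd q) = 0"
    and s: "snd p \<in> S" "snd q \<in> S" "snd p' \<in> S" "snd q' \<in> S"
    by (auto simp: loc_rel_def)
  have "(u * v) * ((fst p * fst q) * (snd p' * snd q') - (fst p' * fst q') * (snd p * snd q)) =
      v * fst q * snd q' * (u * (fst p * snd p' - fst p' * snd p)) +
      u * fst p' * snd p * (v * (fst q * snd q' - fst q' * snd q))"
    by (simp add: algebra_simps)
  also have "\<dots> = 0" using u v by simp
  finally have "(u * v) * ((fst p * fst q) * (snd p' * snd q') -
      (fst p' * fst q') * (snd p * snd q)) = 0" .
  moreover have "u * v \<in> S" using S u v by (auto simp: submonoid_def)
  ultimately show ?thesis
    using s S unfolding loc_rel_def frac_mult_def submonoid_def by (auto intro!: bexI[of _ "u * v"])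
qed

lemma loc_rel_uminus:
  assumes "loc_rel S p p'" shows "loc_rel S (frac_uminus p) (frac_uminus p')"
proof -
  from assms obtain u where u: "u \<in> S" "u * (fst p * snd p' - fst p' * snd p) = 0"
    and s: "snd p \<in> S" "snd p' \<in> S"
    by (auto simp: loc_rel_def)
  have "u * (- fst p * snd p' - - fst p' * snd p) = - (u * (fst p * snd p' - fst p' * snd p))"
    by (simp add: algebra_simps)
  also have "\<dots> = 0" using u by simp
  finally have "u * (- fst p * snd p' - - fst p' * snd p) = 0" .
  then show ?thesis using s u(1) unfolding loc_rel_def frac_uminus_def by auto
qed

text \<open>Fractions whose cross products agree are equal; this settles all ring axioms below.\<close>

lemma loc_relI:
  "submonoid S \<Longrightarrow> snd p \<in> S \<Longrightarrow> snd q \<in> S \<Longrightarrow> fst p * snd q = fst q * snd p \<Longrightarrow> loc_rel S p q"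
  by (auto simp: loc_rel_def submonoid_def)

lemma loc_rel_snd: "loc_rel S p q \<Longrightarrow> snd p \<in> S \<and> snd q \<in> S"
  by (simp add: loc_rel_def)

lemma submonoid_mult: "submonoid S \<Longrightarrow> a \<in> S \<Longrightarrow> b \<in> S \<Longrightarrow> a * b \<in> S"
  by (simp add: submonoid_def)

lemma submonoid_one: "submonoid S \<Longrightarrow> 1 \<in> S"
  by (simp add: submonoid_def)

lemmas frac_defs = frac_add_def frac_mult_def frac_uminus_def


subsection \<open>The ring \<open>R \<otimes> \<rat>\<close>\<close>

text \<open>
  \<open>R \<otimes> \<rat>\<close> is the localisation of \<open>R\<close> at the positive integers. These may be zero divisors, or
  even zero, in \<open>R\<close>.
\<close>

definition pos_ints :: "'a::comm_ring_1 set" where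
  "pos_ints = {of_nat n |n. n > 0}"

lemma submonoid_pos_ints: "submonoid (pos_ints :: 'a::comm_ring_1 set)"
  unfolding submonoid_def pos_ints_def
proof (intro conjI ballI)
  show "1 \<in> {of_nat n :: 'a |n. n > 0}" by (auto intro!: exI[of _ 1])
next
  fix a b :: 'a assume "a \<in> {of_nat n |n. n > 0}" "b \<in> {of_nat n |n. n > 0}"
  then obtain m n where "a = of_nat m" "b = of_nat n" "m > 0" "n > 0" by auto
  then show "a * b \<in> {of_nat n |n. n > 0}" by (auto intro!: exI[of _ "m * n"])
qed

quotient_type (overloaded) 'a rationalization = "'a::comm_ring_1 \<times> 'a" / partial: "loc_rel pos_ints"
  by (rule part_equivp_loc_rel[OF submonoid_pos_ints])

instantiation rationalization :: (comm_ring_1) "{comm_ring, comm_monoid_mult}"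
begin

lift_definition zero_rationalization :: "'a rationalization" is "(0, 1)"
  by (rule loc_rel_refl) (simp_all add: submonoid_pos_ints submonoid_one)

lift_definition one_rationalization :: "'a rationalization" is "(1, 1)"
  by (rule loc_rel_refl) (simp_all add: submonoid_pos_ints submonoid_one)

lift_definition plus_rationalization :: "'a rationalization \<Rightarrow> 'a rationalization \<Rightarrow> 'a rationalization"
  is frac_add by (rule loc_rel_add[OF submonoid_pos_ints])

lift_definition times_rationalization :: "'a rationalization \<Rightarrow> 'a rationalization \<Rightarrow> 'a rationalization"
  is frac_mult by (rule loc_rel_mult[OF submonoid_pos_ints])

lift_definition uminus_rationalization :: "'a rationalization \<Rightarrow> 'a rationalization"
  is frac_uminus by (rule loc_rel_uminus)

definition minus_rationalization :: "'a rationalization \<Rightarrow> 'a rationalization \<Rightarrow> 'a rationalization"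
  where "a - b = a + - b" for a b :: "'a rationalization"

instance
proof
  fix a b c :: "'a rationalization"
  note [simp] = submonoid_pos_ints submonoid_mult[OF submonoid_pos_ints]
    submonoid_one[OF submonoid_pos_ints]
  note [dest!] = loc_rel_snd
  show "a + b + c = a + (b + c)"
    by transfer (rule loc_relI; auto simp: frac_defs algebra_simps)
  show "a + b = b + a"
    by transfer (rule loc_relI; auto simp: frac_defs algebra_simps)
  show "0 + a = a"
    by transfer (rule loc_relI; auto simp: frac_defs algebra_simps)
  show "- a + a = 0"
    by transfer (rule loc_relI; auto simp: frac_defs algebra_simps)
  show "a - b = a + - b" by (simp add: minus_rationalization_def)
  show "a * b * c = a * (b * c)"
    by transfer (rule loc_relI; auto simp: frac_defs algebra_simps)
  show "a * b = b * a"
    by transfer (rule loc_relI; auto simp: frac_defs algebra_simps)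
  show "1 * a = a"
    by transfer (rule loc_relI; auto simp: frac_defs algebra_simps)
  show "(a + b) * c = a * c + b * c"
    by transfer (rule loc_relI; auto simp: frac_defs algebra_simps)
qed

end

text \<open>\<open>rfrac r n = r \<otimes> (1/n)\<close>; the value at \<open>n = 0\<close> is junk.\<close>

lift_definition rfrac :: "'a::comm_ring_1 \<Rightarrow> nat \<Rightarrow> 'a rationalization"
  is "\<lambda>r n. if n = 0 then (0, 1) else (r, of_nat n)"
  by (rule loc_rel_refl[OF submonoid_pos_ints])
     (auto simp: submonoid_one[OF submonoid_pos_ints], auto simp: pos_ints_def)

abbreviation to_rat :: "'a::comm_ring_1 \<Rightarrow> 'a rationalization" where
  "to_rat r \<equiv> rfrac r 1"

lemma of_nat_pos_ints: "n > 0 \<Longrightarrow> of_nat n \<in> pos_ints"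
  by (auto simp: pos_ints_def)

lemma rfrac_eq_iff:
  assumes "m > 0" "n > 0"
  shows "rfrac a m = rfrac b n \<longleftrightarrow> (\<exists>k>0. of_nat k * (a * of_nat n - b * of_nat m) = 0)"
proof -
  have "rfrac a m = rfrac b n \<longleftrightarrow> loc_rel pos_ints (a, of_nat m) (b, of_nat n)"
    using assms by transfer simp
  also have "\<dots> \<longleftrightarrow> (\<exists>u\<in>pos_ints. u * (a * of_nat n - b * of_nat m) = 0)"
    using assms by (simp add: loc_rel_def of_nat_pos_ints)
  also have "\<dots> \<longleftrightarrow> (\<exists>k>0. of_nat k * (a * of_nat n - b * of_nat m) = 0)"
    unfolding pos_ints_def by blast
  finally show ?thesis .
qed

lemma rfrac_cases: obtains r n where "n > 0" "q = rfrac r n"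
proof -
  have "\<exists>r n. n > 0 \<and> q = rfrac r n"
  proof transfer
    fix q :: "'a \<times> 'a" assume q: "loc_rel pos_ints q q"
    then obtain n where n: "n > 0" "snd q = of_nat n"
      by (auto simp: loc_rel_def pos_ints_def)
    then have "loc_rel pos_ints q (fst q, of_nat n)"
      using q by (metis prod.collapse)
    then show "\<exists>r n. n > 0 \<and> loc_rel pos_ints q (if n = 0 then (0, 1) else (r, of_nat n))"
      using n(1) by (intro exI[of _ "fst q"] exI[of _ n]) auto
  qed
  then show thesis using that by blast
qed

lemma rfrac_add:
  assumes "m > 0" "n > 0"
  shows "rfrac a m + rfrac b n = rfrac (a * of_nat n + b * of_nat m) (m * n)"
  using assms
proof transfer
  fix m n :: nat and a b :: 'a
  assume "m > 0" "n > 0"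
  then have "of_nat (m * n) \<in> (pos_ints :: 'a set)" by (intro of_nat_pos_ints) simp
  then show "loc_rel pos_ints
      (frac_add (if m = 0 then (0, 1) else (a, of_nat m)) (if n = 0 then (0, 1) else (b, of_nat n)))
      (if m * n = 0 then (0, 1) else (a * of_nat n + b * of_nat m, of_nat (m * n)))"
    using \<open>m > 0\<close> \<open>n > 0\<close> by (intro loc_relI submonoid_pos_ints) (simp_all add: frac_add_def)
qed

lemma rfrac_mult:
  assumes "m > 0" "n > 0"
  shows "rfrac a m * rfrac b n = rfrac (a * b) (m * n)"
  using assms
proof transfer
  fix m n :: nat and a b :: 'a
  assume "m > 0" "n > 0"
  then have "of_nat (m * n) \<in> (pos_ints :: 'a set)" by (intro of_nat_pos_ints) simp
  then show "loc_rel pos_ints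
      (frac_mult (if m = 0 then (0, 1) else (a, of_nat m)) (if n = 0 then (0, 1) else (b, of_nat n)))
      (if m * n = 0 then (0, 1) else (a * b, of_nat (m * n)))"
    using \<open>m > 0\<close> \<open>n > 0\<close> by (intro loc_relI submonoid_pos_ints) (simp_all add: frac_mult_def)
qed

lemma to_rat_0: "to_rat 0 = 0" and to_rat_1: "to_rat 1 = 1"
  by (transfer, simp add: loc_rel_refl submonoid_pos_ints submonoid_one)+


subsection \<open>The total ring of fractions\<close>

definition non_zero_divisor :: "'b::comm_ring_1 \<Rightarrow> bool" where
  "non_zero_divisor a \<longleftrightarrow> (\<forall>b. a * b = 0 \<longrightarrow> b = 0)"

lemma non_zero_divisor_1: "non_zero_divisor 1"
  by (simp add: non_zero_divisor_def)

lemma non_zero_divisor_mult: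
  assumes "non_zero_divisor a" "non_zero_divisor b"
  shows "non_zero_divisor (a * b)"
  unfolding non_zero_divisor_def
proof (intro allI impI)
  fix c assume "a * b * c = 0"
  then have "a * (b * c) = 0" by (simp add: mult.assoc)
  then have "b * c = 0" using assms(1) unfolding non_zero_divisor_def by blast
  then show "c = 0" using assms(2) unfolding non_zero_divisor_def by blast
qed

lemma submonoid_nzd: "submonoid (Collect non_zero_divisor)"
  by (simp add: submonoid_def non_zero_divisor_1 non_zero_divisor_mult)

quotient_type (overloaded) 'b total_fract =
  "'b::comm_ring_1 \<times> 'b" / partial: "loc_rel (Collect non_zero_divisor)"
  by (rule part_equivp_loc_rel[OF submonoid_nzd])

instantiation total_fract :: (comm_ring_1) comm_ring_1
begin

lift_definition zero_total_fract :: "'a total_fract" is "(0, 1)"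
  by (rule loc_rel_refl[OF submonoid_nzd]) (simp add: non_zero_divisor_1)

lift_definition one_total_fract :: "'a total_fract" is "(1, 1)"
  by (rule loc_rel_refl[OF submonoid_nzd]) (simp add: non_zero_divisor_1)

lift_definition plus_total_fract :: "'a total_fract \<Rightarrow> 'a total_fract \<Rightarrow> 'a total_fract"
  is frac_add by (rule loc_rel_add[OF submonoid_nzd])

lift_definition times_total_fract :: "'a total_fract \<Rightarrow> 'a total_fract \<Rightarrow> 'a total_fract"
  is frac_mult by (rule loc_rel_mult[OF submonoid_nzd])

lift_definition uminus_total_fract :: "'a total_fract \<Rightarrow> 'a total_fract"
  is frac_uminus by (rule loc_rel_uminus)

definition minus_total_fract :: "'a total_fract \<Rightarrow> 'a total_fract \<Rightarrow> 'a total_fract"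
  where "a - b = a + - b" for a b :: "'a total_fract"

instance
proof
  fix a b c :: "'a total_fract"
  note [dest!] = loc_rel_snd
  note [simp] = non_zero_divisor_1 non_zero_divisor_mult
  note I = loc_relI[OF submonoid_nzd]
  show "a + b + c = a + (b + c)"
    by transfer (rule I; auto simp: frac_defs algebra_simps)
  show "a + b = b + a"
    by transfer (rule I; auto simp: frac_defs algebra_simps)
  show "0 + a = a"
    by transfer (rule I; auto simp: frac_defs algebra_simps)
  show "- a + a = 0"
    by transfer (rule I; auto simp: frac_defs algebra_simps)
  show "a - b = a + - b" by (simp add: minus_total_fract_def)
  show "a * b * c = a * (b * c)"
    by transfer (rule I; auto simp: frac_defs algebra_simps)
  show "a * b = b * a"
    by transfer (rule I; auto simp: frac_defs algebra_simps)
  show "1 * a = a"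
    by transfer (rule I; auto simp: frac_defs algebra_simps)
  show "(a + b) * c = a * c + b * c"
    by transfer (rule I; auto simp: frac_defs algebra_simps)
  show "(0 :: 'a total_fract) \<noteq> 1"
  proof transfer
    show "\<not> loc_rel (Collect non_zero_divisor) (0, 1) (1 :: 'a, 1)"
      unfolding loc_rel_def non_zero_divisor_def by (auto intro: exI[of _ 1])
  qed
qed

end

text \<open>\<open>tfrac a s = a/s\<close>; the value is junk if \<open>s\<close> is a zero divisor.\<close>

lift_definition tfrac :: "'b::comm_ring_1 \<Rightarrow> 'b \<Rightarrow> 'b total_fract"
  is "\<lambda>a s. if non_zero_divisor s then (a, s) else (0, 1)"
  by (rule loc_rel_refl[OF submonoid_nzd]) (auto simp: non_zero_divisor_1)

lemma tfrac_eq_iff: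
  assumes "non_zero_divisor s" "non_zero_divisor u"
  shows "tfrac a s = tfrac b u \<longleftrightarrow> a * u = b * s"
proof -
  have "tfrac a s = tfrac b u \<longleftrightarrow> loc_rel (Collect non_zero_divisor) (a, s) (b, u)"
    using assms by transfer simp
  also have "\<dots> \<longleftrightarrow> (\<exists>v\<in>Collect non_zero_divisor. v * (a * u - b * s) = 0)"
    using assms by (simp add: loc_rel_def)
  also have "\<dots> \<longleftrightarrow> a * u - b * s = 0"
  proof
    assume "\<exists>v\<in>Collect non_zero_divisor. v * (a * u - b * s) = 0"
    then show "a * u - b * s = 0" unfolding non_zero_divisor_def by blast
  next
    assume "a * u - b * s = 0"
    then show "\<exists>v\<in>Collect non_zero_divisor. v * (a * u - b * s) = 0"
      using submonoid_one[OF submonoid_nzd] by (intro bexI[of _ 1]) simp_all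
  qed
  finally show ?thesis by simp
qed


section \<open>Formal group laws\<close>

text \<open>
  Iterated power series rings are read from the outside in: for \<open>F :: 'a fps fps\<close> in \<open>R[[x,y]]\<close>,
  \<open>F $ i $ j\<close> is the coefficient of \<open>x\<^sup>i y\<^sup>j\<close>, and \<open>G $ i $ j $ k\<close> is the coefficient of
  \<open>x\<^sup>i y\<^sup>j z\<^sup>k\<close> in \<open>G :: 'a fps fps fps\<close>.

  \<open>fgl_add F a b\<close> and \<open>fgl_add3 F a b\<close> are \<open>F(a,b)\<close> for power series \<open>a, b\<close> in one and in three
  variables without constant term: then \<open>a\<^sup>m b\<^sup>n\<close> has no terms of total degree below \<open>m + n\<close>, so the
  finite sums contain all nonzero contributions.
\<close>

definition fgl_add :: "'a::comm_ring_1 fps fps \<Rightarrow> 'a fps \<Rightarrow> 'a fps \<Rightarrow> 'a fps" where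
  "fgl_add F a b = Abs_fps (\<lambda>k. \<Sum>m\<le>k. \<Sum>n\<le>k. F $ m $ n * (a ^ m * b ^ n) $ k)"

definition fgl_add3 ::
  "'a::comm_ring_1 fps fps \<Rightarrow> 'a fps fps fps \<Rightarrow> 'a fps fps fps \<Rightarrow> 'a fps fps fps" where
  "fgl_add3 F a b = Abs_fps (\<lambda>i. Abs_fps (\<lambda>j. Abs_fps (\<lambda>k.
     \<Sum>m\<le>i+j+k. \<Sum>n\<le>i+j+k. F $ m $ n * (a ^ m * b ^ n) $ i $ j $ k)))"

definition formal_group_law :: "'a::comm_ring_1 fps fps \<Rightarrow> bool" where
  "formal_group_law F \<longleftrightarrow>
     (let x = fps_X; z = fps_const (fps_const fps_X);
          Fxy = Abs_fps (\<lambda>i. Abs_fps (\<lambda>j. fps_const (F $ i $ j)));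
          Fyz = fps_const F
      in fgl_add3 F Fxy z = fgl_add3 F x Fyz) \<and>
     (\<forall>i j. i + j < 2 \<longrightarrow> F $ i $ j = (fps_X + fps_const fps_X) $ i $ j)"

definition fgl_inverse :: "'a::comm_ring_1 fps fps \<Rightarrow> 'a fps \<Rightarrow> 'a fps" where
  "fgl_inverse F a = (THE b. b $ 0 = 0 \<and> fgl_add F a b = 0 \<and> fgl_add F b a = 0)"

primrec fgl_mult_nat :: "'a::comm_ring_1 fps fps \<Rightarrow> nat \<Rightarrow> 'a fps" where
  "fgl_mult_nat F 0 = 0"
| "fgl_mult_nat F (Suc n) = fgl_add F (fgl_mult_nat F n) fps_X"

text \<open>The \<open>n\<close>-series \<open>[n]\<^sub>F(t)\<close> and the bracket \<open>\<langle>n\<rangle>\<^sub>F = [n]\<^sub>F(t)/t\<close>.\<close>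

definition fgl_mult :: "'a::comm_ring_1 fps fps \<Rightarrow> int \<Rightarrow> 'a fps" where
  "fgl_mult F n = (if n \<ge> 0 then fgl_mult_nat F (nat n) else fgl_inverse F (fgl_mult_nat F (nat (- n))))"

definition fgl_bracket :: "'a::comm_ring_1 fps fps \<Rightarrow> int \<Rightarrow> 'a fps" where
  "fgl_bracket F n = fps_shift 1 (fgl_mult F n)"

definition fgl_fact :: "'a::comm_ring_1 fps fps \<Rightarrow> nat \<Rightarrow> 'a fps" where
  "fgl_fact F n = (\<Prod>i=1..n. fgl_bracket F (int i))"


subsection \<open>Logarithm and exponential\<close>

text \<open>
  \<open>(\<partial>\<^sub>yF)(u,0) = \<Sum>\<^sub>i F\<^sub>i\<^sub>1 u\<^sup>i\<close> has constant term 1. The library's inversion and integration of power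
  series assume coefficients with an inverse operation.
\<close>

definition fgl_log :: "'a::comm_ring_1 fps fps \<Rightarrow> 'a rationalization fps" where
  "fgl_log F =
     (let w = unit_inv (Abs_fps (\<lambda>i. to_rat (F $ i $ 1)))
      in Abs_fps (\<lambda>n. if n = 0 then 0 else w $ (n - 1) * rfrac 1 n))"

text \<open>The library's \<^const>\<open>fps_compose\<close>, without the requirement \<open>0 \<noteq> 1\<close> on the coefficients.\<close>

definition fps_comp ::
  "'b::{comm_ring, comm_monoid_mult} fps \<Rightarrow> 'b fps \<Rightarrow> 'b fps" where
  "fps_comp f g = Abs_fps (\<lambda>n. \<Sum>i\<le>n. f $ i * (g ^ i) $ n)"

definition fgl_exp :: "'a::comm_ring_1 fps fps \<Rightarrow> 'a rationalization fps" where
  "fgl_exp F = (THE E. E $ 0 = 0 \<and> fps_comp (fgl_log F) E = fps_X \<and> fps_comp E (fgl_log F) = fps_X)"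


section \<open>The function \<open>F log\<close>\<close>

text \<open>
  The ring \<open>(R \<otimes> \<rat>)[[t,x-1]]\<close> is the type \<open>'a rationalization fps fps\<close>, where the outer variable is
  \<open>x - 1\<close> and the inner one is \<open>t\<close>; so \<open>x\<close> is \<open>1 + fps_X\<close>.
\<close>

definition log_series :: "'a::comm_ring_1 rationalization fps" where
  "log_series = Abs_fps (\<lambda>n. if n = 0 then 0 else rfrac ((- 1) ^ (n + 1)) n)"

text \<open>\<open>t/\<ell>\<^sub>F(t)\<close> is the inverse of \<open>\<ell>\<^sub>F(t)/t = 1 + \<dots>\<close>\<close>

definition Flog :: "'a::comm_ring_1 fps fps \<Rightarrow> 'a rationalization fps fps" where
  "Flog F = fps_const (unit_inv (fps_shift 1 (fgl_log F))) * Abs_fps (\<lambda>n. fps_const (log_series $ n))"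

definition euler_op :: "'a::comm_ring_1 rationalization fps fps \<Rightarrow> 'a rationalization fps fps" where
  "euler_op f = (1 + fps_X) * Abs_fps (\<lambda>n. fps_const (to_rat (of_nat (n + 1))) * f $ (n + 1))"

text \<open>
  \<open>nabla F f = (1/(tx)) \<Sum>\<^sub>k e\<^sub>k \<ell>\<^sub>F(t)\<^sup>k (x \<partial>\<^sub>x)\<^sup>k f\<close>, where \<open>e\<^sub>k\<close> are the coefficients of \<open>\<E>\<^sub>F\<close>. As
  \<open>\<ell>\<^sub>F(t)\<^sup>k\<close> is divisible by \<open>t\<^sup>k\<close>, only \<open>k \<le> j\<close> contribute to the coefficient of \<open>t\<^sup>j\<close>; as
  \<open>e\<^sub>0 = 0\<close>, the result is divisible by \<open>t\<close>.
\<close>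

definition exp_log_euler ::
  "'a::comm_ring_1 fps fps \<Rightarrow> 'a rationalization fps fps \<Rightarrow> 'a rationalization fps fps" where
  "exp_log_euler F f = Abs_fps (\<lambda>i. Abs_fps (\<lambda>j.
     \<Sum>k\<le>j. fgl_exp F $ k * (fgl_log F ^ k * (euler_op ^^ k) f $ i) $ j))"

definition nabla ::
  "'a::comm_ring_1 fps fps \<Rightarrow> 'a rationalization fps fps \<Rightarrow> 'a rationalization fps fps" where
  "nabla F f = unit_inv (1 + fps_X) * Abs_fps (\<lambda>i. fps_shift 1 (exp_log_euler F f $ i))"

text \<open>
  The ring \<open>(R \<otimes> \<rat>)[[t,x-1,y-1]]\<close> is the type \<open>'a rationalization fps fps fps\<close>, where the outer
  variable is \<open>x - 1\<close>, the middle one is \<open>y - 1\<close> and the inner one is \<open>t\<close>.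

  For \<open>f(x) = \<Sum>\<^sub>n c\<^sub>n (x-1)\<^sup>n\<close> and \<open>p\<close> of constant term 1 in \<open>x-1, y-1\<close>, \<open>fps_at2 f p\<close> is
  \<open>f(p) = \<Sum>\<^sub>n c\<^sub>n (p-1)\<^sup>n\<close>; terms with \<open>n > i + j\<close> do not contribute to the coefficient of
  \<open>(x-1)\<^sup>i (y-1)\<^sup>j\<close>.
\<close>

definition fps_at2 ::
  "'b::{comm_ring, comm_monoid_mult} fps \<Rightarrow> 'b fps fps \<Rightarrow> 'b fps fps" where
  "fps_at2 f p = Abs_fps (\<lambda>i. Abs_fps (\<lambda>j. \<Sum>n\<le>i+j. f $ n * ((p - 1) ^ n) $ i $ j))"

definition var_x :: "'b::{comm_ring, comm_monoid_mult} fps fps" where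
  "var_x = 1 + fps_X"

definition var_y :: "'b::{comm_ring, comm_monoid_mult} fps fps" where
  "var_y = 1 + fps_const fps_X"


section \<open>The polynomials \<open>(x + y)\<^sup>n\<^sub>s\<close>\<close>

text \<open>
  \<open>A[x,y]\<close> is the type \<open>'l poly poly\<close>, where the outer variable is \<open>x\<close> and the inner one is \<open>y\<close>.
  The ring \<open>R[[t]]\<close> with all \<open>\<langle>i\<rangle>\<^sub>F\<close>, \<open>i \<ge> 1\<close>, inverted depends on \<open>F\<close>; it is represented as the subring
  \<open>fgl_loc F\<close> of the total ring of fractions of \<open>R[[t]]\<close>, which it is when no \<open>[i]\<^sub>F(t)\<close> is a zero
  divisor.
\<close>

definition bracket_monoid :: "'a::comm_ring_1 fps fps \<Rightarrow> 'a fps set" where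
  "bracket_monoid F = {prod_list (map (fgl_bracket F \<circ> int) is) |is. \<forall>i\<in>set is. i \<ge> 1}"

definition fgl_loc :: "'a::comm_ring_1 fps fps \<Rightarrow> 'a fps total_fract set" where
  "fgl_loc F = {tfrac a s |a s. s \<in> bracket_monoid F}"

definition nabla_poly ::
  "'a::comm_ring_1 fps fps \<Rightarrow> 'a fps total_fract poly poly \<Rightarrow> 'a fps total_fract poly poly" where
  "nabla_poly F p =
     (\<Sum>i\<le>degree p. monom (smult (tfrac (fgl_bracket F (int i)) 1) (coeff p i)) (i - 1))"

definition subst_y_minus_x :: "'l::comm_ring_1 poly poly \<Rightarrow> 'l poly" where
  "subst_y_minus_x p = poly (map_poly (\<lambda>q. pcompose q [:0, - 1:]) p) [:0, 1:]"

definition is_binomial_seq ::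
  "'a::comm_ring_1 fps fps \<Rightarrow> (nat \<Rightarrow> 'a fps total_fract poly poly) \<Rightarrow> bool" where
  "is_binomial_seq F P \<longleftrightarrow>
     (\<forall>n i j. coeff (coeff (P n) i) j \<in> fgl_loc F) \<and>
     P 0 = 1 \<and>
     (\<forall>n>0. subst_y_minus_x (P n) = 0) \<and>
     (\<forall>n>0. nabla_poly F (P n) = smult [:tfrac (fgl_bracket F (int n)) 1:] (P (n - 1)))"

definition binomial_seq ::
  "'a::comm_ring_1 fps fps \<Rightarrow> nat \<Rightarrow> 'a fps total_fract poly poly" where
  "binomial_seq F = (THE P. is_binomial_seq F P)"

text \<open>\<open>(x - 1)\<^sup>n\<^sub>s\<close>\<close>

definition twisted_power :: "'a::comm_ring_1 fps fps \<Rightarrow> nat \<Rightarrow> 'a fps total_fract poly" where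
  "twisted_power F n = map_poly (\<lambda>q. poly q (- 1)) (binomial_seq F n)"

text \<open>
  The canonical map from \<open>fgl_loc F\<close> to \<open>(R \<otimes> \<rat>)[[t]]\<close>, where \<open>\<langle>i\<rangle>\<^sub>F = i + \<dots>\<close> is invertible, and
  the map it induces from polynomials in \<open>x\<close> to \<open>(R \<otimes> \<rat>)[[t,x-1]]\<close>.
\<close>

definition fps_to_rat :: "'a::comm_ring_1 fps \<Rightarrow> 'a rationalization fps" where
  "fps_to_rat f = Abs_fps (\<lambda>n. to_rat (f $ n))"

definition loc_to_rat :: "'a::comm_ring_1 fps fps \<Rightarrow> 'a fps total_fract \<Rightarrow> 'a rationalization fps" where
  "loc_to_rat F z =
     (THE c. \<exists>a. \<exists>s\<in>bracket_monoid F. z = tfrac a s \<and> c * fps_to_rat s = fps_to_rat a)"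

definition poly_to_rat ::
  "'a::comm_ring_1 fps fps \<Rightarrow> 'a fps total_fract poly \<Rightarrow> 'a rationalization fps fps" where
  "poly_to_rat F p = (\<Sum>i\<le>degree p. fps_const (loc_to_rat F (coeff p i)) * (1 + fps_X) ^ i)"


section \<open>Convergence\<close>

text \<open>
  \<open>adic_sums a f\<close>: the series \<open>\<Sum>\<^sub>n\<^sub>\<ge>\<^sub>1 a\<^sub>n\<close> converges to \<open>f\<close> in the adic topology of the ideal \<open>(t, x-1)\<close>.
  The topology of the library on \<open>'b fps fps\<close> is finer: it is discrete in \<open>t\<close>.
\<close>

definition adic_sums :: "(nat \<Rightarrow> 'b::{comm_ring, comm_monoid_mult} fps fps) \<Rightarrow> 'b fps fps \<Rightarrow> bool" where
  "adic_sums a f \<longleftrightarrow>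
     (\<forall>K. \<exists>N0. \<forall>N\<ge>N0. \<forall>i j. i + j < K \<longrightarrow> (\<Sum>n=1..N. a n) $ i $ j = f $ i $ j)"

end

theory Submission
  imports Defs
begin

text \<open>
  Over \<open>R \<otimes> \<rat>\<close> the law \<open>F\<close> becomes additive in the coordinate \<open>\<ell>\<^sub>F\<close>. Indeed the coefficient of \<open>z\<close> in the
  associativity law says that \<open>\<partial>\<^sub>yF(x,y) p(y) = p(F(x,y))\<close> for \<open>p(u) = \<partial>\<^sub>yF(u,0)\<close>, and \<open>\<ell>\<^sub>F' = 1/p\<close>, so
  \<open>\<ell>\<^sub>F(F(x,y))\<close> and \<open>\<ell>\<^sub>F(x) + \<ell>\<^sub>F(y)\<close> have the same derivative in \<open>y\<close>, and they agree at \<open>y = 0\<close>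
  (\<open>comp2_additive\<close>, \<open>log_hom\<close>). Hence \<open>[n]\<^sub>F(t) = \<E>\<^sub>F(n \<ell>\<^sub>F(t))\<close> for every integer \<open>n\<close> (\<open>X_brac\<close>). As
  \<open>\<theta> = x \<partial>\<^sub>x\<close> multiplies \<open>x\<^sup>n\<close> by \<open>n\<close>, the operator \<open>\<nabla> = (1/(t x)) \<E>\<^sub>F(\<ell>\<^sub>F(t) \<theta>)\<close> sends \<open>x\<^sup>n\<close> to
  \<open>\<langle>n\<rangle> x\<^sup>n\<^sup>-\<^sup>1\<close> for positive and for negative \<open>n\<close>.

  \<^item> Since \<open>\<theta> log x = 1\<close> and \<open>\<theta> 1 = 0\<close>, only the linear term of \<open>\<E>\<^sub>F(\<ell>\<^sub>F \<theta>)\<close> acts on \<open>log x\<close>, and it gives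
    \<open>\<ell>\<^sub>F(t)\<close>; this yields \<open>\<nabla>(F log x) = 1/x\<close> (\<open>nabla_Flog\<close>).

  \<^item> Additivity of \<open>F log\<close> is \<open>comp2_additive\<close> again, now for the multiplicative group law
    \<open>u + v + u v\<close> with \<open>u = x - 1\<close> and \<open>v = y - 1\<close> (\<open>Flog_mult\<close>).

  \<^item> The expansion is the Taylor expansion at \<open>x = 1\<close> with respect to \<open>\<nabla>\<close>. The divided powers
    \<open>v\<^sub>n = (x-1)\<^sup>n\<^sub>s / n!\<^sub>F\<close> satisfy \<open>\<nabla> v\<^sub>n = v\<^sub>n\<^sub>-\<^sub>1\<close> and vanish at \<open>x = 1\<close> for \<open>n > 0\<close>, so the \<open>N\<close>-th partial sum
    and \<open>F log x\<close> have the same iterated derivatives \<open>\<nabla>\<^sup>m\<close> at \<open>x = 1\<close> for all \<open>m \<le> N\<close>: for \<open>m > 0\<close> these are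
    \<open>\<langle>-m+1\<rangle> \<cdots> \<langle>-1\<rangle>\<close>, because \<open>\<nabla>\<^sup>m F log x\<close> is this number times \<open>x\<^sup>-\<^sup>m\<close>. What makes the series converge is
    that \<open>f(1) = 0\<close> and \<open>\<nabla> f \<in> (t, x-1)\<^sup>N\<close> imply \<open>f \<in> (t, x-1)\<^sup>N\<^sup>+\<^sup>1\<close> (\<open>nabla_raises_order\<close>). Applied repeatedly to
    the difference, it shows that the remainder lies in \<open>(t, x-1)\<^sup>N\<^sup>+\<^sup>1\<close> (\<open>Flog_taylor\<close>).

  The ring \<open>R \<otimes> \<rat>\<close> may be trivial. The general theory that precedes the section on rational coefficients is therefore
  developed over commutative rings in which \<open>0 = 1\<close> is possible, which also allows a single theory of
  formal group laws to be used both over \<open>R\<close> and over \<open>R \<otimes> \<rat>\<close>.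
\<close>

section \<open>Filtered rings and convergent sums\<close>

text \<open>
  Substituting power series into power series requires infinite sums in several rings. They are
  handled by the ideals of a filtration: \<open>sums_to f s\<close> below is convergence with the explicit rate
  that \<open>f n \<in> I n\<close> forces, which makes limits unique and products easy to control.
\<close>

locale filtration =
  fixes I :: "nat \<Rightarrow> 'b::{comm_ring, comm_monoid_mult} set"
  assumes all: "x \<in> I 0"
    and zero: "0 \<in> I n"
    and add: "x \<in> I n \<Longrightarrow> y \<in> I n \<Longrightarrow> x + y \<in> I n"
    and uminus: "x \<in> I n \<Longrightarrow> - x \<in> I n"
    and mult: "x \<in> I m \<Longrightarrow> y \<in> I n \<Longrightarrow> x * y \<in> I (m + n)"
    and decreasing: "m \<le> n \<Longrightarrow> I n \<subseteq> I m"
    and separated: "(\<And>n. x \<in> I n) \<Longrightarrow> x = 0"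
begin

lemma ideal_left: "y \<in> I n \<Longrightarrow> x * y \<in> I n"
  using mult[of x 0 y n] all by simp

lemma ideal_right: "y \<in> I n \<Longrightarrow> y * x \<in> I n"
  using ideal_left[of y n x] by (simp add: mult.commute)

lemma diff: "x \<in> I n \<Longrightarrow> y \<in> I n \<Longrightarrow> x - y \<in> I n"
  using add[of x n "- y"] uminus by simp

lemma sum_mem: "(\<And>i. i \<in> A \<Longrightarrow> f i \<in> I n) \<Longrightarrow> sum f A \<in> I n"
  by (induction A rule: infinite_finite_induct) (auto intro: zero add)

lemma power_mem: "a \<in> I 1 \<Longrightarrow> a ^ n \<in> I n"
proof (induction n)
  case (Suc n)
  then show ?case using mult[of a 1 "a ^ n" n] by simp
qed (simp add: all)

definition sums_to :: "(nat \<Rightarrow> 'b) \<Rightarrow> 'b \<Rightarrow> bool" where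
  "sums_to f s \<longleftrightarrow> (\<forall>N. s - sum f {..<N} \<in> I N)"

lemma sums_to_unique:
  assumes "sums_to f s" "sums_to f s'"
  shows "s = s'"
proof -
  have "s - s' \<in> I n" for n
    using diff[of "s - sum f {..<n}" n "s' - sum f {..<n}"] assms by (simp add: sums_to_def)
  then have "s - s' = 0" by (rule separated)
  then show ?thesis by simp
qed

text \<open>The Cauchy product: modulo \<open>I N\<close> both factors may be replaced by their \<open>N\<close>-th partial sums, and
  in the product of these the terms outside the triangle \<open>i + j < N\<close> lie in \<open>I N\<close>.\<close>

lemma sums_to_mult:
  assumes f: "\<And>n. f n \<in> I n" and g: "\<And>n. g n \<in> I n"
    and s: "sums_to f s" "sums_to g s'"
  shows "sums_to (\<lambda>n. \<Sum>i\<le>n. f i * g (n - i)) (s * s')"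
  unfolding sums_to_def
proof
  fix N
  let ?S = "sum f {..<N}" and ?T = "sum g {..<N}"
  let ?A = "{(i, j). i < N \<and> j < N}" and ?B = "{(i, j). i + j < N}"
  have fin: "finite ?A" by (rule finite_subset[of _ "{..<N} \<times> {..<N}"]) auto
  have "?S * ?T = (\<Sum>(i, j)\<in>{..<N} \<times> {..<N}. f i * g j)"
    by (simp add: sum_product sum.cartesian_product)
  also have "{..<N} \<times> {..<N} = ?A" by auto
  finally have 1: "?S * ?T = (\<Sum>(i, j)\<in>?A. f i * g j)" .
  have 2: "(\<Sum>n<N. \<Sum>i\<le>n. f i * g (n - i)) = (\<Sum>(i, j)\<in>?B. f i * g j)"
    by (simp add: sum.triangle_reindex)
  have "?S * ?T - (\<Sum>n<N. \<Sum>i\<le>n. f i * g (n - i)) = (\<Sum>(i, j)\<in>?A - ?B. f i * g j)"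
    unfolding 1 2 by (subst sum_diff[OF fin]) auto
  also have "\<dots> \<in> I N"
  proof (rule sum_mem)
    fix p assume "p \<in> ?A - ?B"
    then obtain i j where p: "p = (i, j)" "N \<le> i + j" by auto
    have "f i * g j \<in> I N" using mult[OF f[of i] g[of j]] decreasing[OF p(2)] by blast
    then show "(case p of (i, j) \<Rightarrow> f i * g j) \<in> I N" by (simp add: p(1))
  qed
  finally have 3: "?S * ?T - (\<Sum>n<N. \<Sum>i\<le>n. f i * g (n - i)) \<in> I N" .
  have "s * s' - (\<Sum>n<N. \<Sum>i\<le>n. f i * g (n - i)) =
      (s - ?S) * s' + ?S * (s' - ?T) + (?S * ?T - (\<Sum>n<N. \<Sum>i\<le>n. f i * g (n - i)))"
    by (simp add: algebra_simps)
  moreover have "(s - ?S) * s' \<in> I N" "?S * (s' - ?T) \<in> I N"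
    using s by (auto simp: sums_to_def intro: ideal_left ideal_right)
  ultimately show "s * s' - (\<Sum>n<N. \<Sum>i\<le>n. f i * g (n - i)) \<in> I N"
    using 3 by (simp only: add)
qed

text \<open>With \<open>c\<close> and \<open>d\<close> the coefficients of two series, this is multiplicativity of the
  evaluation at \<open>a\<close>; it is used for all three kinds of substitution below.\<close>

lemma powser_mult:
  assumes a: "a \<in> I 1"
    and s: "sums_to (\<lambda>n. c n * a ^ n) s" "sums_to (\<lambda>n. d n * a ^ n) s'"
  shows "sums_to (\<lambda>n. (\<Sum>i\<le>n. c i * d (n - i)) * a ^ n) (s * s')"
proof -
  have "sums_to (\<lambda>n. \<Sum>i\<le>n. (c i * a ^ i) * (d (n - i) * a ^ (n - i))) (s * s')"
    by (rule sums_to_mult) (auto intro: ideal_left power_mem[OF a] s)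
  moreover have "(\<Sum>i\<le>n. (c i * a ^ i) * (d (n - i) * a ^ (n - i))) =
      (\<Sum>i\<le>n. c i * d (n - i)) * a ^ n" for n
    unfolding sum_distrib_right
  proof (rule sum.cong)
    fix i assume "i \<in> {..n}"
    then have "a ^ n = a ^ i * a ^ (n - i)" by (simp flip: power_add)
    then show "(c i * a ^ i) * (d (n - i) * a ^ (n - i)) = c i * d (n - i) * a ^ n"
      by (simp add: mult_ac)
  qed simp
  ultimately show ?thesis by simp
qed

end

definition fps_ideal :: "nat \<Rightarrow> 'b::zero fps set" where
  "fps_ideal N = {f. \<forall>k<N. f $ k = 0}"

text \<open>The powers of the ideal generated by both variables.\<close>

definition fps2_ideal :: "nat \<Rightarrow> 'b::zero fps fps set" where
  "fps2_ideal N = {f. \<forall>i j. i + j < N \<longrightarrow> f $ i $ j = 0}"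

interpretation fps: filtration "fps_ideal :: nat \<Rightarrow> 'b::{comm_ring, comm_monoid_mult} fps set"
proof
  fix x y :: "'b fps" and m n :: nat
  assume xy: "x \<in> fps_ideal m" "y \<in> fps_ideal n"
  have "(x * y) $ k = 0" if "k < m + n" for k
    unfolding fps_mult_nth
  proof (rule sum.neutral, rule ballI)
    fix i assume "i \<in> {0..k}"
    then have "i < m \<or> k - i < n" using that by auto
    then show "x $ i * y $ (k - i) = 0" using xy by (auto simp: fps_ideal_def)
  qed
  then show "x * y \<in> fps_ideal (m + n)" by (simp add: fps_ideal_def)
next
  fix x :: "'b fps" assume x: "\<And>n. x \<in> fps_ideal n"
  have "x $ k = 0" for k using x[of "Suc k"] by (simp add: fps_ideal_def)
  then show "x = 0" by (auto intro!: fps_ext)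
qed (auto simp: fps_ideal_def)

interpretation fps2: filtration "fps2_ideal :: nat \<Rightarrow> 'b::{comm_ring, comm_monoid_mult} fps fps set"
proof
  fix x y :: "'b fps fps" and m n :: nat
  assume xy: "x \<in> fps2_ideal m" "y \<in> fps2_ideal n"
  have "(x * y) $ k $ l = 0" if "k + l < m + n" for k l
    unfolding fps_mult_nth fps_sum_nth
  proof (intro sum.neutral ballI)
    fix i j assume "i \<in> {0..k}" "j \<in> {0..l}"
    then have "i + j < m \<or> (k - i) + (l - j) < n" using that by auto
    then show "x $ i $ j * y $ (k - i) $ (l - j) = 0" using xy by (auto simp: fps2_ideal_def)
  qed
  then show "x * y \<in> fps2_ideal (m + n)" by (simp add: fps2_ideal_def)
next
  fix x :: "'b fps fps" assume x: "\<And>n. x \<in> fps2_ideal n"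
  have "x $ i $ j = 0" for i j using x[of "Suc (i + j)"] by (simp add: fps2_ideal_def)
  then show "x = 0" by (auto intro!: fps_ext)
qed (auto simp: fps2_ideal_def)

lemma fps_ideal_1: "f \<in> fps_ideal (Suc 0) \<longleftrightarrow> f $ 0 = 0"
  by (simp add: fps_ideal_def)

lemma fps2_ideal_1: "f \<in> fps2_ideal (Suc 0) \<longleftrightarrow> f $ 0 $ 0 = 0"
  by (simp add: fps2_ideal_def)

text \<open>A continuous additive map commutes with convergent sums.\<close>

lemma sums_to_hom:
  assumes "filtration I" "filtration J"
    and add: "\<And>x y. \<phi> (x + y) = \<phi> x + \<phi> y"
    and cont: "\<And>x N. x \<in> I N \<Longrightarrow> \<phi> x \<in> J N"
    and s: "filtration.sums_to I f s"
  shows "filtration.sums_to J (\<lambda>n. \<phi> (f n)) (\<phi> s)"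
proof -
  interpret I: filtration I by fact
  interpret J: filtration J by fact
  have "\<phi> 0 + \<phi> 0 = \<phi> 0" by (simp flip: add)
  then have zero: "\<phi> 0 = 0" by simp
  have "\<phi> (x - y) + \<phi> y = \<phi> x" for x y by (simp flip: add)
  then have diff: "\<phi> (x - y) = \<phi> x - \<phi> y" for x y by (metis add_diff_cancel_right')
  have sum: "\<phi> (sum f A) = (\<Sum>n\<in>A. \<phi> (f n))" for A
    by (induction A rule: infinite_finite_induct) (auto simp: zero add)
  show ?thesis unfolding J.sums_to_def
    using s cont by (simp add: I.sums_to_def flip: sum diff)
qed


section \<open>Substitution into power series\<close>

lemma X_power_nth: "(fps_X ^ k :: 'b::{comm_ring, comm_monoid_mult} fps) $ n = (if n = k then 1 else 0)"
  by (induction k arbitrary: n) auto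

lemma const_power: "fps_const c ^ n = fps_const (c ^ n :: 'b::{comm_ring, comm_monoid_mult})"
  by (induction n) auto

lemma power_0_pos: "n > 0 \<Longrightarrow> (0 :: 'b::{comm_ring, comm_monoid_mult}) ^ n = 0"
  by (cases n) auto

lemma power_nth_below: "a $ 0 = 0 \<Longrightarrow> k < n \<Longrightarrow> (a ^ n) $ k = 0"
  for a :: "'b::{comm_ring, comm_monoid_mult} fps"
  using fps.power_mem[of a n] by (auto simp: fps_ideal_def)

lemma power_nth2_below: "G $ 0 $ 0 = 0 \<Longrightarrow> i + j < n \<Longrightarrow> (G ^ n) $ i $ j = 0"
  for G :: "'b::{comm_ring, comm_monoid_mult} fps fps"
  using fps2.power_mem[of G n] by (auto simp: fps2_ideal_def)

subsection \<open>A one-variable series at a one-variable series\<close>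

lemma fps_comp_sums:
  fixes f :: "'b::{comm_ring, comm_monoid_mult} fps"
  assumes a: "a $ 0 = 0"
  shows "fps.sums_to (\<lambda>n. fps_const (f $ n) * a ^ n) (fps_comp f a)"
  unfolding fps.sums_to_def
proof
  fix N
  have "fps_comp f a $ k = (\<Sum>n<N. f $ n * (a ^ n) $ k)" if "k < N" for k
    unfolding fps_comp_def fps_nth_Abs_fps
    by (rule sum.mono_neutral_left) (use that in \<open>auto simp: power_nth_below[OF a]\<close>)
  then show "fps_comp f a - (\<Sum>n<N. fps_const (f $ n) * a ^ n) \<in> fps_ideal N"
    by (simp add: fps_ideal_def fps_sum_nth)
qed

lemma fps_comp_eqI:
  fixes f :: "'b::{comm_ring, comm_monoid_mult} fps"
  assumes "a $ 0 = 0" "fps.sums_to (\<lambda>n. fps_const (f $ n) * a ^ n) s"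
  shows "fps_comp f a = s"
  using fps.sums_to_unique fps_comp_sums assms by blast

lemma fps_comp_add: "fps_comp (f + g) a = fps_comp f a + fps_comp g a"
  by (rule fps_ext) (simp add: fps_comp_def distrib_right sum.distrib)

lemma fps_comp_const: "fps_comp (fps_const c) a = fps_const c"
proof (rule fps_ext)
  fix n
  have "fps_comp (fps_const c) a $ n = (\<Sum>i\<in>{0}. fps_const c $ i * (a ^ i) $ n)"
    unfolding fps_comp_def fps_nth_Abs_fps by (rule sum.mono_neutral_right) auto
  then show "fps_comp (fps_const c) a $ n = fps_const c $ n" by simp
qed

lemma fps_comp_mult:
  fixes f :: "'b::{comm_ring, comm_monoid_mult} fps"
  assumes a: "a $ 0 = 0"
  shows "fps_comp (f * g) a = fps_comp f a * fps_comp g a"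
proof (rule fps_comp_eqI[OF a])
  have "fps_const ((f * g) $ n) = (\<Sum>i\<le>n. fps_const (f $ i) * fps_const (g $ (n - i)))" for n
    by (rule fps_ext) (simp add: fps_mult_nth fps_sum_nth atLeast0AtMost)
  then show "fps.sums_to (\<lambda>n. fps_const ((f * g) $ n) * a ^ n) (fps_comp f a * fps_comp g a)"
    using fps.powser_mult[OF _ fps_comp_sums[OF a, of f] fps_comp_sums[OF a, of g]] a
    by (simp add: fps_ideal_1)
qed

lemma fps_comp_X_left:
  fixes a :: "'b::{comm_ring, comm_monoid_mult} fps"
  assumes a: "a $ 0 = 0"
  shows "fps_comp fps_X a = a"
proof (rule fps_ext)
  fix n
  have "fps_comp fps_X a $ n = (\<Sum>i\<in>{1} \<inter> {..n}. fps_X $ i * (a ^ i) $ n)"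
    unfolding fps_comp_def fps_nth_Abs_fps by (rule sum.mono_neutral_right) (auto simp: fps_X_def)
  then show "fps_comp fps_X a $ n = a $ n" using a by (cases n) auto
qed

lemma fps_comp_X_right:
  fixes f :: "'b::{comm_ring, comm_monoid_mult} fps"
  shows "fps_comp f fps_X = f"
  by (rule fps_ext) (simp add: fps_comp_def X_power_nth mult_delta_right)

lemma fps_comp_nth_0: "fps_comp f a $ 0 = f $ 0"
  by (simp add: fps_comp_def)

lemma fps_comp_0_right: "fps_comp f 0 = fps_const (f $ 0)"
  for f :: "'b::{comm_ring, comm_monoid_mult} fps"
proof (rule fps_ext)
  fix n
  have "fps_comp f 0 $ n = (\<Sum>i\<in>{0}. f $ i * ((0::'b fps) ^ i) $ n)"
    unfolding fps_comp_def fps_nth_Abs_fps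
    by (rule sum.mono_neutral_right) (auto simp: power_0_pos intro: ccontr)
  then show "fps_comp f 0 $ n = fps_const (f $ 0) $ n" by simp
qed

lemma fps_comp_power:
  fixes f :: "'b::{comm_ring, comm_monoid_mult} fps"
  assumes "a $ 0 = 0"
  shows "fps_comp (f ^ n) a = fps_comp f a ^ n"
  by (induction n) (simp_all add: fps_comp_mult[OF assms] fps_comp_const flip: fps_const_1_eq_1)

lemma fps_comp_continuous:
  fixes f :: "'b::{comm_ring, comm_monoid_mult} fps"
  assumes "a $ 0 = 0" "f \<in> fps_ideal N"
  shows "fps_comp f a \<in> fps_ideal N"
  unfolding fps_ideal_def fps_comp_def mem_Collect_eq
  using assms(2) by (auto intro!: sum.neutral simp: fps_ideal_def)

text \<open>Substituting \<open>h\<close> is a continuous ring homomorphism, so it may be applied to \<open>\<Sum>\<^sub>n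
  f\<^sub>n g\<^sup>n\<close> term by term.\<close>

lemma fps_comp_assoc:
  fixes f :: "'b::{comm_ring, comm_monoid_mult} fps"
  assumes g: "g $ 0 = 0" and h: "h $ 0 = 0"
  shows "fps_comp (fps_comp f g) h = fps_comp f (fps_comp g h)"
proof (rule sym, rule fps_comp_eqI)
  have "fps.sums_to (\<lambda>n. fps_comp (fps_const (f $ n) * g ^ n) h) (fps_comp (fps_comp f g) h)"
    by (rule sums_to_hom[OF fps.filtration_axioms fps.filtration_axioms])
       (auto simp: fps_comp_add h g intro: fps_comp_continuous fps_comp_sums)
  then show "fps.sums_to (\<lambda>n. fps_const (f $ n) * fps_comp g h ^ n) (fps_comp (fps_comp f g) h)"
    by (simp add: fps_comp_mult h fps_comp_const fps_comp_power)
qed (simp add: fps_comp_nth_0 g)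


subsection \<open>A one-variable series at a two-variable series\<close>

definition comp2 :: "'b::{comm_ring, comm_monoid_mult} fps \<Rightarrow> 'b fps fps \<Rightarrow> 'b fps fps" where
  "comp2 f G = Abs_fps (\<lambda>i. Abs_fps (\<lambda>j. \<Sum>n\<le>i + j. f $ n * (G ^ n) $ i $ j))"

abbreviation const2 :: "'b::zero \<Rightarrow> 'b fps fps" where
  "const2 c \<equiv> fps_const (fps_const c)"

lemma comp2_sums:
  assumes G: "G $ 0 $ 0 = 0"
  shows "fps2.sums_to (\<lambda>n. const2 (f $ n) * G ^ n) (comp2 f G)"
  unfolding fps2.sums_to_def
proof
  fix N
  have "comp2 f G $ i $ j = (\<Sum>n<N. f $ n * (G ^ n) $ i $ j)" if "i + j < N" for i j
    unfolding comp2_def fps_nth_Abs_fps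
    by (rule sum.mono_neutral_left) (use that in \<open>auto simp: power_nth2_below[OF G]\<close>)
  then show "comp2 f G - (\<Sum>n<N. const2 (f $ n) * G ^ n) \<in> fps2_ideal N"
    by (simp add: fps2_ideal_def fps_sum_nth)
qed

lemma comp2_eqI:
  assumes "G $ 0 $ 0 = 0" "fps2.sums_to (\<lambda>n. const2 (f $ n) * G ^ n) s"
  shows "comp2 f G = s"
  using fps2.sums_to_unique comp2_sums assms by blast

lemma comp2_mult:
  assumes G: "G $ 0 $ 0 = 0"
  shows "comp2 (f * g) G = comp2 f G * comp2 g G"
proof (rule comp2_eqI[OF G])
  have "const2 ((f * g) $ n) = (\<Sum>i\<le>n. const2 (f $ i) * const2 (g $ (n - i)))" for n
    by (intro fps_ext) (simp add: fps_mult_nth fps_sum_nth atLeast0AtMost)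
  then show "fps2.sums_to (\<lambda>n. const2 ((f * g) $ n) * G ^ n) (comp2 f G * comp2 g G)"
    using fps2.powser_mult[OF _ comp2_sums[OF G, of f] comp2_sums[OF G, of g]] G
    by (simp add: fps2_ideal_1)
qed

lemma comp2_const: "comp2 (fps_const c) G = const2 c"
proof (intro fps_ext)
  fix i j
  have "comp2 (fps_const c) G $ i $ j = (\<Sum>n\<in>{0}. fps_const c $ n * (G ^ n) $ i $ j)"
    unfolding comp2_def fps_nth_Abs_fps by (rule sum.mono_neutral_right) auto
  then show "comp2 (fps_const c) G $ i $ j = const2 c $ i $ j" by simp
qed

lemma comp2_add: "comp2 (f + g) G = comp2 f G + comp2 g G"
  by (intro fps_ext) (simp add: comp2_def distrib_right sum.distrib)

lemma comp2_X_left: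
  assumes G: "G $ 0 $ 0 = 0"
  shows "comp2 fps_X G = G"
proof (intro fps_ext)
  fix i j
  have "comp2 fps_X G $ i $ j = (\<Sum>n\<in>{1} \<inter> {..i + j}. fps_X $ n * (G ^ n) $ i $ j)"
    unfolding comp2_def fps_nth_Abs_fps by (rule sum.mono_neutral_right) (auto simp: fps_X_def)
  then show "comp2 fps_X G $ i $ j = G $ i $ j" using G by (cases "i + j = 0") auto
qed

lemma comp2_X: "comp2 f fps_X = Abs_fps (\<lambda>i. fps_const (f $ i))"
proof (intro fps_ext)
  fix i j
  have "comp2 f fps_X $ i $ j = (\<Sum>n\<in>{i}. f $ n * (fps_X ^ n) $ i $ j)"
    unfolding comp2_def fps_nth_Abs_fps
    by (rule sum.mono_neutral_right) (auto simp: X_power_nth split: if_splits)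
  then show "comp2 f fps_X $ i $ j = Abs_fps (\<lambda>i. fps_const (f $ i)) $ i $ j"
    by (simp add: X_power_nth)
qed

lemma comp2_const_X: "comp2 f (fps_const fps_X) = fps_const f"
proof (intro fps_ext)
  fix i j
  have "comp2 f (fps_const fps_X) $ i $ j = (\<Sum>n\<in>{j}. f $ n * (fps_const fps_X ^ n) $ i $ j)"
    unfolding comp2_def fps_nth_Abs_fps by (rule sum.mono_neutral_right) (auto simp: X_power_nth const_power split: if_splits)
  then show "comp2 f (fps_const fps_X) $ i $ j = fps_const f $ i $ j"
    by (simp add: X_power_nth const_power)
qed

subsection \<open>A two-variable series at two one-variable series\<close>

definition subst2 ::
  "'b::{comm_ring, comm_monoid_mult} fps fps \<Rightarrow> 'b fps \<Rightarrow> 'b fps \<Rightarrow> 'b fps" where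
  "subst2 f a b = Abs_fps (\<lambda>k. \<Sum>m\<le>k. \<Sum>n\<le>k. f $ m $ n * (a ^ m * b ^ n) $ k)"

lemma monomial_nth_below:
  fixes a :: "'b::{comm_ring, comm_monoid_mult} fps"
  assumes "a $ 0 = 0" "b $ 0 = 0" "k < m + n"
  shows "(a ^ m * b ^ n) $ k = 0"
  using fps.mult[OF fps.power_mem[of a m] fps.power_mem[of b n]] assms
  by (auto simp: fps_ideal_def)

lemma subst2_add: "subst2 (f + g) a b = subst2 f a b + subst2 g a b"
  by (rule fps_ext) (simp add: subst2_def distrib_right sum.distrib)

lemma subst2_continuous:
  assumes "a $ 0 = 0" "b $ 0 = 0" "f \<in> fps2_ideal N"
  shows "subst2 f a b \<in> fps_ideal N"
  unfolding fps_ideal_def subst2_def mem_Collect_eq fps_nth_Abs_fps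
proof (intro allI impI sum.neutral ballI)
  fix k m n assume k: "k < N"
  show "f $ m $ n * (a ^ m * b ^ n) $ k = 0"
    using assms k by (cases "k < m + n") (auto simp: monomial_nth_below fps2_ideal_def)
qed

text \<open>In the coefficient of index \<open>k\<close> of a product with \<open>f(b)\<close>, the series may be cut off
  after \<open>b\<^sup>k\<close>.\<close>

lemma fps_comp_mult_nth:
  fixes f :: "'b::{comm_ring, comm_monoid_mult} fps"
  assumes "b $ 0 = 0"
  shows "(fps_comp f b * h) $ k = (\<Sum>n\<le>k. f $ n * (b ^ n * h) $ k)"
proof -
  let ?S = "\<Sum>n<Suc k. fps_const (f $ n) * b ^ n"
  have "(fps_comp f b - ?S) * h \<in> fps_ideal (Suc k)"
    using fps_comp_sums[OF assms, of f] by (intro fps.ideal_right) (simp only: fps.sums_to_def)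
  then have "(fps_comp f b * h) $ k = (?S * h) $ k"
    by (auto simp: fps_ideal_def left_diff_distrib)
  also have "\<dots> = (\<Sum>n<Suc k. (fps_const (f $ n) * (b ^ n * h)) $ k)"
    by (simp only: sum_distrib_right fps_sum_nth mult.assoc)
  finally show ?thesis by (simp add: lessThan_Suc_atMost)
qed

lemma subst2_nth_comp:
  assumes "b $ 0 = 0"
  shows "subst2 f a b $ k = (\<Sum>m\<le>k. (fps_comp (f $ m) b * a ^ m) $ k)"
  by (simp only: subst2_def fps_comp_mult_nth[OF assms] fps_nth_Abs_fps) (simp only: mult.commute)

text \<open>Summing first over the powers of \<open>b\<close> exhibits \<open>f(a,b)\<close> as a one-variable substitution
  of \<open>a\<close>, so that multiplicativity follows by two uses of the Cauchy product.\<close>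

lemma subst2_sums:
  assumes ab: "a $ 0 = 0" "b $ 0 = 0"
  shows "fps.sums_to (\<lambda>m. fps_comp (f $ m) b * a ^ m) (subst2 f a b)"
  unfolding fps.sums_to_def
proof
  fix N
  have "subst2 f a b $ k = (\<Sum>m<N. (fps_comp (f $ m) b * a ^ m) $ k)" if k: "k < N" for k
  proof -
    have "fps_comp (f $ m) b * a ^ m \<in> fps_ideal m" for m
      using fps.ideal_left[OF fps.power_mem[of a m]] ab by (simp add: fps_ideal_1)
    then have "(fps_comp (f $ m) b * a ^ m) $ k = 0" if "k < m" for m
      using that by (auto simp: fps_ideal_def)
    then show ?thesis unfolding subst2_nth_comp[OF ab(2)]
      by (intro sum.mono_neutral_left) (use k in auto)
  qed
  then show "subst2 f a b - (\<Sum>m<N. fps_comp (f $ m) b * a ^ m) \<in> fps_ideal N"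
    by (simp add: fps_ideal_def fps_sum_nth)
qed

lemma subst2_mult_nth:
  assumes ab: "a $ 0 = 0" "b $ 0 = 0"
  shows "(subst2 f a b * h) $ k = (\<Sum>m\<le>k. \<Sum>n\<le>k. f $ m $ n * (a ^ m * b ^ n * h) $ k)"
proof -
  let ?S = "\<Sum>m<Suc k. fps_comp (f $ m) b * a ^ m"
  have "(subst2 f a b - ?S) * h \<in> fps_ideal (Suc k)"
    using subst2_sums[OF ab, of f] by (intro fps.ideal_right) (simp only: fps.sums_to_def)
  then have "(subst2 f a b * h) $ k = (?S * h) $ k"
    by (auto simp: fps_ideal_def left_diff_distrib)
  also have "\<dots> = (\<Sum>m<Suc k. (fps_comp (f $ m) b * (a ^ m * h)) $ k)"
    by (simp only: sum_distrib_right fps_sum_nth mult.assoc)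
  also have "\<dots> = (\<Sum>m\<le>k. \<Sum>n\<le>k. f $ m $ n * (a ^ m * b ^ n * h) $ k)"
    by (simp only: fps_comp_mult_nth[OF ab(2)] lessThan_Suc_atMost) (simp only: mult_ac)
  finally show ?thesis .
qed

lemma fps_comp_0: "fps_comp 0 a = 0"
  by (rule fps_ext) (simp add: fps_comp_def)

lemma fps_comp_sum: "fps_comp (sum f A) a = (\<Sum>i\<in>A. fps_comp (f i) a)"
  by (induction A rule: infinite_finite_induct) (auto simp: fps_comp_add fps_comp_0)

lemma subst2_mult:
  assumes ab: "a $ 0 = 0" "b $ 0 = 0"
  shows "subst2 (f * g) a b = subst2 f a b * subst2 g a b"
proof (rule fps.sums_to_unique[OF subst2_sums[OF ab]])
  have "fps_comp ((f * g) $ m) b = (\<Sum>i\<le>m. fps_comp (f $ i) b * fps_comp (g $ (m - i)) b)" for m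
    by (simp add: fps_mult_nth fps_comp_sum fps_comp_mult ab atLeast0AtMost)
  then show "fps.sums_to (\<lambda>m. fps_comp ((f * g) $ m) b * a ^ m) (subst2 f a b * subst2 g a b)"
    using fps.powser_mult[OF _ subst2_sums[OF ab, of f] subst2_sums[OF ab, of g]] ab
    by (simp add: fps_ideal_1)
qed

lemma subst2_const: "subst2 (const2 c) a b = fps_const c"
proof (rule fps_ext)
  fix k
  have "(\<Sum>n\<le>k. const2 c $ m $ n * (a ^ m * b ^ n) $ k) = (if m = 0 then fps_const c $ k else 0)" for m
  proof -
    have "(\<Sum>n\<le>k. const2 c $ m $ n * (a ^ m * b ^ n) $ k) =
        (\<Sum>n\<in>{0}. const2 c $ m $ n * (a ^ m * b ^ n) $ k)"
      by (rule sum.mono_neutral_right) auto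
    then show ?thesis by simp
  qed
  then show "subst2 (const2 c) a b $ k = fps_const c $ k" by (simp add: subst2_def)
qed

lemma subst2_power:
  assumes "a $ 0 = 0" "b $ 0 = 0"
  shows "subst2 (f ^ n) a b = subst2 f a b ^ n"
  by (induction n) (simp_all add: subst2_mult[OF assms] subst2_const flip: fps_const_1_eq_1)

lemma subst2_nth_0: "subst2 f a b $ 0 = f $ 0 $ 0"
  by (simp add: subst2_def)

text \<open>\<open>f(G)\<close> at \<open>x = a\<close>, \<open>y = b\<close> is \<open>f(G(a,b))\<close>, because the
  evaluation at \<open>(a,b)\<close> is continuous.\<close>

lemma subst2_comp2:
  assumes ab: "a $ 0 = 0" "b $ 0 = 0" and G: "G $ 0 $ 0 = 0"
  shows "subst2 (comp2 f G) a b = fps_comp f (subst2 G a b)"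
proof (rule sym, rule fps_comp_eqI)
  have "fps.sums_to (\<lambda>n. subst2 (const2 (f $ n) * G ^ n) a b) (subst2 (comp2 f G) a b)"
    by (rule sums_to_hom[OF fps2.filtration_axioms fps.filtration_axioms])
       (auto simp: subst2_add ab G intro: subst2_continuous comp2_sums)
  then show "fps.sums_to (\<lambda>n. fps_const (f $ n) * subst2 G a b ^ n) (subst2 (comp2 f G) a b)"
    by (simp add: subst2_mult ab subst2_const subst2_power)
qed (simp add: subst2_nth_0 G)

lemma subst2_X: 
  assumes ab: "a $ 0 = 0" "b $ 0 = 0"
  shows "subst2 fps_X a b = a" 
proof -
  have "fps.sums_to (\<lambda>m. fps_const (fps_X $ m) * a ^ m) (subst2 fps_X a b)"
    using subst2_sums[OF ab, of fps_X]
    by (simp add: fps_X_def if_distrib[of "\<lambda>f. fps_comp f b"] if_distrib[of fps_const] fps_comp_0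
        fps_comp_const[of 1, simplified] cong: if_cong)
  from fps_comp_eqI[OF ab(1) this] show ?thesis by (simp add: fps_comp_X_left ab)
qed

lemma subst2_const_fps:
  assumes ab: "a $ 0 = 0" "b $ 0 = 0"
  shows "subst2 (fps_const f) a b = fps_comp f b"
proof -
  have "fps_const f = comp2 f (fps_const fps_X)" by (simp add: comp2_const_X)
  have "fps.sums_to (\<lambda>m. fps_comp (fps_const f $ m) b * a ^ m) (fps_comp f b)"
    unfolding fps.sums_to_def
  proof
    fix N
    have "(\<Sum>m<N. fps_comp (fps_const f $ m) b * a ^ m) = (if N = 0 then 0 else fps_comp f b)"
      by (induction N) (auto simp: fps_comp_0)
    then show "fps_comp f b - (\<Sum>m<N. fps_comp (fps_const f $ m) b * a ^ m) \<in> fps_ideal N"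
      by (auto simp: fps.all fps.zero)
  qed
  then show ?thesis using fps.sums_to_unique subst2_sums[OF ab, of "fps_const f"] by blast
qed

section \<open>Derivations\<close>

text \<open>Embedding the natural numbers by \<open>of_nat\<close> presupposes \<open>0 \<noteq> 1\<close>, so multiples are
  formed by iterated addition.\<close>

definition nat_mul :: "nat \<Rightarrow> 'b::{comm_ring, comm_monoid_mult} \<Rightarrow> 'b" where
  "nat_mul n x = (\<Sum>i<n. x)"

lemma nat_mul_0 [simp]: "nat_mul 0 x = 0"
  and nat_mul_Suc: "nat_mul (Suc n) x = nat_mul n x + x"
  by (simp_all add: nat_mul_def)

lemma nat_mul_add_left: "nat_mul (m + n) x = nat_mul m x + nat_mul n x"
  by (induction m) (simp_all add: nat_mul_Suc add_ac)

lemma nat_mul_add: "nat_mul n (x + y) = nat_mul n x + nat_mul n y"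
  by (simp add: nat_mul_def sum.distrib)

lemma nat_mul_zero [simp]: "nat_mul n 0 = 0"
  by (simp add: nat_mul_def)

lemma nat_mul_mult_left: "nat_mul n x * y = nat_mul n (x * y)"
  by (simp add: nat_mul_def sum_distrib_right)

lemma nat_mul_mult_right: "x * nat_mul n y = nat_mul n (x * y)"
  by (simp add: nat_mul_def sum_distrib_left)

lemma nat_mul_sum: "nat_mul n (sum f A) = (\<Sum>i\<in>A. nat_mul n (f i))"
  unfolding nat_mul_def by (rule sum.swap)

lemma nat_mul_nth [simp]: "nat_mul n f $ k = nat_mul n (f $ k)"
  by (simp add: nat_mul_def fps_sum_nth)

definition fps_D :: "'b::{comm_ring, comm_monoid_mult} fps \<Rightarrow> 'b fps" where
  "fps_D f = Abs_fps (\<lambda>n. nat_mul (Suc n) (f $ Suc n))"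

lemma fps_D_nth [simp]: "fps_D f $ n = nat_mul (Suc n) (f $ Suc n)"
  by (simp add: fps_D_def)

lemma fps_D_add: "fps_D (f + g) = fps_D f + fps_D g"
  by (rule fps_ext) (simp add: nat_mul_add)

lemma fps_D_const [simp]: "fps_D (fps_const c) = 0"
  by (rule fps_ext) simp

lemma fps_D_0 [simp]: "fps_D 0 = 0"
  by (rule fps_ext) simp

lemma fps_D_sum: "fps_D (sum f A) = (\<Sum>i\<in>A. fps_D (f i))"
  by (induction A rule: infinite_finite_induct) (auto simp: fps_D_add)

lemma fps_D_X [simp]: "fps_D fps_X = 1"
  by (rule fps_ext) (auto simp: nat_mul_def)

lemma fps_D_mult: "fps_D (f * g) = fps_D f * g + f * fps_D g"
proof (rule fps_ext)
  fix n
  have split: "nat_mul (Suc n) (f $ i * g $ (Suc n - i)) =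
      nat_mul i (f $ i) * g $ (Suc n - i) + f $ i * nat_mul (Suc n - i) (g $ (Suc n - i))"
    if "i \<le> Suc n" for i
    using that nat_mul_add_left[of i "Suc n - i" "f $ i * g $ (Suc n - i)"]
    by (simp add: nat_mul_mult_left nat_mul_mult_right)
  have "fps_D (f * g) $ n = (\<Sum>i=0..Suc n. nat_mul (Suc n) (f $ i * g $ (Suc n - i)))"
    by (simp only: fps_D_nth fps_mult_nth nat_mul_sum)
  also have "\<dots> = (\<Sum>i=0..Suc n. nat_mul i (f $ i) * g $ (Suc n - i)) +
      (\<Sum>i=0..Suc n. f $ i * nat_mul (Suc n - i) (g $ (Suc n - i)))"
    by (simp only: sum.distrib[symmetric], rule sum.cong) (simp_all add: split)
  also have "(\<Sum>i=0..Suc n. nat_mul i (f $ i) * g $ (Suc n - i)) = (fps_D f * g) $ n"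
    unfolding sum.atLeast0_atMost_Suc_shift by (simp add: fps_mult_nth)
  also have "(\<Sum>i=0..Suc n. f $ i * nat_mul (Suc n - i) (g $ (Suc n - i))) = (f * fps_D g) $ n"
    by (simp add: fps_mult_nth Suc_diff_le)
  finally show "fps_D (f * g) $ n = (fps_D f * g + f * fps_D g) $ n" by simp
qed

definition fps_Dy :: "'b::{comm_ring, comm_monoid_mult} fps fps \<Rightarrow> 'b fps fps" where
  "fps_Dy f = Abs_fps (\<lambda>i. fps_D (f $ i))"

lemma fps_Dy_nth [simp]: "fps_Dy f $ i = fps_D (f $ i)"
  by (simp add: fps_Dy_def)

lemma fps_Dy_add: "fps_Dy (f + g) = fps_Dy f + fps_Dy g"
  by (rule fps_ext) (simp add: fps_D_add)

lemma fps_Dy_mult: "fps_Dy (f * g) = fps_Dy f * g + f * fps_Dy g"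
  by (rule fps_ext) (simp add: fps_mult_nth fps_D_sum fps_D_mult sum.distrib)

lemma fps_Dy_const [simp]: "fps_Dy (fps_const f) = fps_const (fps_D f)"
  by (rule fps_ext) simp

lemma fps_Dy_X [simp]: "fps_Dy fps_X = 0"
  by (rule fps_ext) (auto simp: fps_D_const[of 1, simplified])

lemma fps_Dy_sum: "fps_Dy (sum f A) = (\<Sum>i\<in>A. fps_Dy (f i))"
  by (rule fps_ext) (simp add: fps_sum_nth fps_D_sum)

lemma fps_Dy_power: "fps_Dy (f ^ Suc n) = nat_mul (Suc n) (f ^ n * fps_Dy f)"
proof (induction n)
  case (Suc n)
  have "fps_Dy (f ^ Suc (Suc n)) = fps_Dy f * f ^ Suc n + f * nat_mul (Suc n) (f ^ n * fps_Dy f)"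
    by (subst power_Suc) (simp only: fps_Dy_mult Suc.IH)
  then show ?case by (simp add: nat_mul_Suc[of "Suc n"] nat_mul_mult_right mult_ac add_ac)
qed (simp add: nat_mul_Suc)

lemma fps_Dy_continuous: "f \<in> fps2_ideal (Suc N) \<Longrightarrow> fps_Dy f \<in> fps2_ideal N"
  by (auto simp: fps2_ideal_def)

text \<open>The chain rule: \<open>\<partial>\<^sub>y\<close> lowers the order by at most one, so it may be applied term by term.\<close>

lemma fps_Dy_comp2:
  assumes G: "G $ 0 $ 0 = 0"
  shows "fps_Dy (comp2 f G) = comp2 (fps_D f) G * fps_Dy G"
proof (rule fps2.sums_to_unique)
  let ?a = "\<lambda>n. const2 (fps_D f $ n) * G ^ n * fps_Dy G"
  show "fps2.sums_to ?a (comp2 (fps_D f) G * fps_Dy G)"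
    using comp2_sums[OF G, of "fps_D f"]
    by (auto simp: fps2.sums_to_def simp flip: sum_distrib_right left_diff_distrib
        intro: fps2.ideal_right)
  have diff: "fps_Dy (f - g) = fps_Dy f - fps_Dy g" for f g :: "'a fps fps"
    using fps_Dy_add[of "f - g" g] by simp
  have a: "fps_Dy (const2 (f $ Suc n) * G ^ Suc n) = ?a n" for n
    by (subst fps_Dy_mult, subst fps_Dy_power)
       (intro fps_ext, simp add: nat_mul_mult_left nat_mul_mult_right mult.assoc)
  show "fps2.sums_to ?a (fps_Dy (comp2 f G))"
    unfolding fps2.sums_to_def
  proof
    fix N
    have "fps_Dy (comp2 f G - (\<Sum>n<Suc N. const2 (f $ n) * G ^ n)) \<in> fps2_ideal N"
      by (rule fps_Dy_continuous) (use comp2_sums[OF G, of f] in \<open>simp only: fps2.sums_to_def\<close>)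
    moreover have "fps_Dy (\<Sum>n<Suc N. const2 (f $ n) * G ^ n) = sum ?a {..<N}"
      unfolding sum.lessThan_Suc_shift fps_Dy_add fps_Dy_sum a by simp
    ultimately show "fps_Dy (comp2 f G) - sum ?a {..<N} \<in> fps2_ideal N"
      by (simp only: diff)
  qed
qed

section \<open>Inverses\<close>

lemma unit_inv_eqI:
  fixes a b :: "'b::{comm_ring, comm_monoid_mult}"
  assumes "a * b = 1"
  shows "unit_inv a = b"
  unfolding unit_inv_def
proof (rule the_equality)
  fix c assume "a * c = 1"
  have "c = (a * b) * c" using assms by simp
  also have "\<dots> = b * (a * c)" by (simp add: mult_ac)
  also have "\<dots> = b" using \<open>a * c = 1\<close> by simp
  finally show "c = b" .
qed fact

text \<open>The inverse of \<open>1 - a\<close> is the geometric series at \<open>a\<close>.\<close>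

lemma fps_unit_exists:
  fixes f :: "'b::{comm_ring, comm_monoid_mult} fps"
  assumes c: "f $ 0 * c = 1"
  shows "\<exists>g. f * g = 1"
proof -
  define a where "a = 1 - fps_const c * f"
  have a: "a $ 0 = 0" using c by (simp add: a_def mult.commute)
  let ?g = "Abs_fps (\<lambda>_. 1) :: 'b fps"
  have "(1 - fps_X) * ?g = 1"
    by (rule fps_ext) (simp add: left_diff_distrib)
  then have "fps_comp (1 - fps_X) a * fps_comp ?g a = 1"
    using fps_comp_const[of 1 a] by (simp flip: fps_comp_mult[OF a])
  moreover have "fps_comp (1 - fps_X) a + a = 1"
    using fps_comp_add[of "1 - fps_X" fps_X a] fps_comp_const[of 1 a] by (simp add: fps_comp_X_left[OF a])
  then have "fps_comp (1 - fps_X) a = f * fps_const c" by (simp add: a_def algebra_simps)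
  ultimately show ?thesis by (metis mult.assoc)
qed

lemma fps_unit_inv:
  fixes f :: "'b::{comm_ring, comm_monoid_mult} fps"
  assumes "f $ 0 * c = 1"
  shows "f * unit_inv f = 1"
  using fps_unit_exists[OF assms] unit_inv_eqI[of f] by auto

text \<open>A map for which the coefficient of index \<open>N\<close> of the value depends only on smaller coefficients of
  the argument has a fixed point: the iterates of 0 stabilise coefficient by coefficient. This produces both compositional
  inverses and inverses for a formal group law.\<close>

lemma contraction_fixpoint:
  fixes \<Phi> :: "'b::zero fps \<Rightarrow> 'b fps"
  assumes 0: "\<And>f. \<Phi> f $ 0 = 0"
    and contr: "\<And>f g N. f $ 0 = 0 \<Longrightarrow> g $ 0 = 0 \<Longrightarrow> (\<And>k. k < N \<Longrightarrow> f $ k = g $ k) \<Longrightarrow> \<Phi> f $ N = \<Phi> g $ N"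
  shows "\<exists>f. f $ 0 = 0 \<and> \<Phi> f = f"
proof -
  define it where "it n = (\<Phi> ^^ n) 0" for n
  have it0: "it n $ 0 = 0" for n by (cases n) (simp_all add: it_def 0)
  have itS: "it (Suc n) = \<Phi> (it n)" for n by (simp add: it_def)
  have step: "k < n \<Longrightarrow> it n $ k = it (Suc n) $ k" for n k
  proof (induction n arbitrary: k)
    case (Suc n)
    have "\<Phi> (it n) $ k = \<Phi> (it (Suc n)) $ k"
      by (rule contr) (use Suc it0 in auto)
    then show ?case by (simp only: itS)
  qed simp
  have stable: "k < n \<Longrightarrow> it n $ k = it (Suc k) $ k" for n k
  proof (induction n)
    case (Suc n)
    then show ?case using step[of k n] by (cases "k = n") auto
  qed simp
  define f where "f = Abs_fps (\<lambda>k. it (Suc k) $ k)"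
  have f0: "f $ 0 = 0" by (simp add: f_def it0)
  have "\<Phi> f $ k = f $ k" for k
  proof -
    have "\<Phi> f $ k = \<Phi> (it k) $ k"
      by (rule contr) (simp_all add: f0 it0 f_def stable[symmetric])
    then show ?thesis by (simp add: f_def itS)
  qed
  with f0 show ?thesis by (auto intro: fps_ext)
qed

lemma power_diff_mem:
  fixes f g :: "'b::{comm_ring, comm_monoid_mult} fps"
  assumes f: "f \<in> fps_ideal 1" and g: "g \<in> fps_ideal 1" and fg: "f - g \<in> fps_ideal N"
  shows "f ^ Suc n - g ^ Suc n \<in> fps_ideal (N + n)"
proof (induction n)
  case (Suc n)
  have "f ^ Suc (Suc n) - g ^ Suc (Suc n) = f * (f ^ Suc n - g ^ Suc n) + (f - g) * g ^ Suc n"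
    by (simp add: algebra_simps)
  moreover have "f * (f ^ Suc n - g ^ Suc n) \<in> fps_ideal (N + Suc n)"
    using fps.mult[OF f Suc.IH] by simp
  moreover have "(f - g) * g ^ Suc n \<in> fps_ideal (N + Suc n)"
    by (rule fps.mult[OF fg fps.power_mem[OF g]])
  ultimately show ?case by (simp only: fps.add)
qed (simp add: fg)

text \<open>\<open>E\<close> is a fixed point of the map that solves \<open>l(E) = x\<close> for the linear term of
  \<open>l\<close>. It is a contraction since \<open>E\<^sup>n\<close> with \<open>n \<ge> 2\<close> involves in degree
  \<open>k\<close> only coefficients of \<open>E\<close> below \<open>k\<close>.\<close>

lemma comp_right_inverse_exists:
  fixes l :: "'b::{comm_ring, comm_monoid_mult} fps"
  assumes l0: "l $ 0 = 0" and c: "l $ 1 * c = 1"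
  shows "\<exists>E. E $ 0 = 0 \<and> fps_comp l E = fps_X"
proof -
  define \<Phi> where "\<Phi> E = Abs_fps (\<lambda>k. if k = 0 then 0 else
      c * (fps_X $ k - (\<Sum>n=2..k. l $ n * (E ^ n) $ k)))" for E :: "'b fps"
  have "\<exists>E. E $ 0 = 0 \<and> \<Phi> E = E"
  proof (rule contraction_fixpoint)
    fix f g :: "'b fps" and N
    assume f: "f $ 0 = 0" and g: "g $ 0 = 0" and fg: "\<And>k. k < N \<Longrightarrow> f $ k = g $ k"
    have "(f ^ n) $ N = (g ^ n) $ N" if "n \<ge> 2" for n
    proof -
      define m where "m = n - 1"
      have n: "n = Suc m" "m \<ge> 1" using that by (auto simp: m_def)
      have "f ^ Suc m - g ^ Suc m \<in> fps_ideal (N + m)"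
        by (rule power_diff_mem) (simp_all add: fps_ideal_def f g fg)
      then show ?thesis using n by (simp add: fps_ideal_def)
    qed
    then show "\<Phi> f $ N = \<Phi> g $ N" by (simp add: \<Phi>_def)
  qed (simp add: \<Phi>_def)
  then obtain E where E0: "E $ 0 = 0" and E: "\<Phi> E = E" by blast
  have "fps_comp l E $ k = fps_X $ k" for k
  proof (cases "k = 0")
    case False
    have set: "{..k} = insert 0 (insert 1 {2..k})" using False by auto
    have "l $ 1 * E $ k = (l $ 1 * c) * (fps_X $ k - (\<Sum>n=2..k. l $ n * (E ^ n) $ k))"
      using False by (subst E[symmetric]) (simp add: \<Phi>_def mult.assoc)
    then show ?thesis unfolding fps_comp_def fps_nth_Abs_fps set
      using c by (simp add: l0)
  qed (simp add: fps_comp_def l0)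
  then have "fps_comp l E = fps_X" by (rule fps_ext)
  with E0 show ?thesis by blast
qed

text \<open>A right inverse has itself a right inverse, which must be the original series.\<close>

lemma comp_inverse_exists:
  fixes l :: "'b::{comm_ring, comm_monoid_mult} fps"
  assumes l0: "l $ 0 = 0" and c: "l $ 1 * c = 1"
  shows "\<exists>E. E $ 0 = 0 \<and> fps_comp l E = fps_X \<and> fps_comp E l = fps_X"
proof -
  obtain E where E: "E $ 0 = 0" "fps_comp l E = fps_X"
    using comp_right_inverse_exists[OF assms] by blast
  have "fps_comp l E $ 1 = l $ 1 * E $ 1" by (simp add: fps_comp_def l0)
  then have "E $ 1 * l $ 1 = 1" using E by (simp add: mult.commute)
  then obtain G where G: "G $ 0 = 0" "fps_comp E G = fps_X"
    using comp_right_inverse_exists[OF E(1)] by blast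
  have "l = fps_comp (fps_comp l E) G"
    by (simp add: fps_comp_assoc E(1) G fps_comp_X_right)
  also have "\<dots> = G" by (simp add: E(2) fps_comp_X_left G(1))
  finally show ?thesis using E G by blast
qed


section \<open>Logarithms\<close>

lemma at_y_0_power:
  fixes G :: "'b::{comm_ring, comm_monoid_mult} fps fps"
  shows "(G ^ n) $ i $ 0 = (Abs_fps (\<lambda>i. G $ i $ 0) ^ n) $ i"
  by (induction n arbitrary: i) (simp_all add: fps_mult_nth fps_sum_nth)

text \<open>
  If \<open>p\<close> is invariant under \<open>G\<close>, that is \<open>\<partial>\<^sub>yG(x,y) p(y) = p(G(x,y))\<close>, and \<open>l'\<close> is proportional to \<open>1/p\<close>, then
  \<open>l(G(x,y))\<close> and \<open>l(x) + l(y)\<close> have the same derivative in \<open>y\<close>; they agree at \<open>y = 0\<close>.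
\<close>

lemma comp2_additive:
  fixes G :: "'b::{comm_ring, comm_monoid_mult} fps fps"
  assumes torsion_free: "\<And>n (x::'b). nat_mul (Suc n) x = 0 \<Longrightarrow> x = 0"
    and G: "\<And>i. G $ i $ 0 = fps_X $ i"
    and inv: "fps_Dy G * fps_const p = comp2 p G"
    and p: "p * w = 1"
    and l: "fps_D l * p = fps_const c" "l $ 0 = 0"
  shows "comp2 l G = comp2 l fps_X + comp2 l (fps_const fps_X)"
proof -
  let ?R = "comp2 l fps_X + comp2 l (fps_const fps_X)"
  have G0: "G $ 0 $ 0 = 0" by (simp add: G)
  have "fps_Dy (comp2 l G) * fps_const p = comp2 (fps_D l) G * comp2 p G"
    by (simp add: fps_Dy_comp2[OF G0] mult.assoc inv)
  also have "\<dots> = const2 c" by (simp add: l comp2_const flip: comp2_mult[OF G0])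
  finally have 1: "fps_Dy (comp2 l G) * fps_const p = const2 c" .
  have "fps_Dy (comp2 l fps_X) = 0" by (rule fps_ext) (simp add: comp2_X)
  then have "fps_Dy ?R * fps_const p = const2 c"
    by (simp add: fps_Dy_add comp2_const_X l)
  with 1 have "fps_Dy (comp2 l G) * fps_const p * fps_const w = fps_Dy ?R * fps_const p * fps_const w"
    by simp
  then have eq: "fps_Dy (comp2 l G) = fps_Dy ?R" by (simp add: mult.assoc p)
  show ?thesis
  proof (intro fps_ext)
    fix i j
    show "comp2 l G $ i $ j = ?R $ i $ j"
    proof (cases j)
      case 0
      have "Abs_fps (\<lambda>i. G $ i $ 0) = fps_X" by (rule fps_ext) (simp only: fps_nth_Abs_fps G)
      then have "comp2 l G $ i $ 0 = fps_comp l fps_X $ i"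
        by (simp add: comp2_def fps_comp_def at_y_0_power)
      then show ?thesis by (simp add: 0 fps_comp_X_right comp2_X comp2_const_X l)
    next
      case (Suc k)
      have "fps_Dy (comp2 l G) $ i $ k = fps_Dy ?R $ i $ k" using eq by simp
      then have "nat_mul (Suc k) (comp2 l G $ i $ j) = nat_mul (Suc k) (?R $ i $ j)"
        by (simp add: Suc)
      then have "nat_mul (Suc k) (comp2 l G $ i $ j - ?R $ i $ j) = 0"
        using nat_mul_add[of "Suc k" "comp2 l G $ i $ j - ?R $ i $ j" "?R $ i $ j"] by simp
      then show ?thesis using torsion_free by fastforce
    qed
  qed
qed

section \<open>Formal group laws\<close>

lemma X_power_mult_nth: "(fps_X ^ n * f :: 'b::{comm_ring, comm_monoid_mult} fps) $ k =
    (if n \<le> k then f $ (k - n) else 0)"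
  by (induction n arbitrary: k) (auto simp: mult.assoc)

lemma power_nth_0: "(f ^ n :: 'b::{comm_ring, comm_monoid_mult} fps) $ 0 = (f $ 0) ^ n"
  by (induction n) auto

text \<open>A series \<open>g = x + \<dots>\<close> that is idempotent under composition is cancelled by its inverse.\<close>

lemma comp_idempotent:
  fixes g :: "'b::{comm_ring, comm_monoid_mult} fps"
  assumes "g $ 0 = 0" "g $ 1 = 1" "fps_comp g g = g"
  shows "g = fps_X"
proof -
  obtain E where E: "E $ 0 = 0" "fps_comp g E = fps_X"
    using comp_right_inverse_exists[of g 1] assms by auto
  have "g = fps_comp g (fps_comp g E)" by (simp add: E fps_comp_X_right)
  also have "\<dots> = fps_comp g E" by (subst fps_comp_assoc[symmetric]) (simp_all add: assms E(1))
  finally have "g = fps_comp g E" .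
  also have "\<dots> = fps_X" by (rule E(2))
  finally show ?thesis .
qed

text \<open>The associativity law in terms of coefficients: in that of \<open>x\<^sup>i y\<^sup>j z\<^sup>k\<close>, the
  left-hand side is the contribution of \<open>F(F(x,y),z)\<close>, where only the \<open>k\<close>-th power of
  \<open>z\<close> matters, and similarly for \<open>F(x,F(y,z))\<close>.\<close>

locale fgl =
  fixes F :: "'b::{comm_ring, comm_monoid_mult} fps fps"
  assumes F_00: "F $ 0 $ 0 = 0" and F_10: "F $ 1 $ 0 = 1" and F_01: "F $ 0 $ 1 = 1"
    and assoc_coeffs: "(\<Sum>m\<le>i+j. F $ m $ k * (F ^ m) $ i $ j) = (\<Sum>n\<le>j+k. F $ i $ n * (F ^ n) $ j $ k)"
begin

definition column :: "nat \<Rightarrow> 'b fps" where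
  "column k = Abs_fps (\<lambda>m. F $ m $ k)"

lemma assoc_comp2: "comp2 (column k) F $ i $ j = comp2 (F $ i) F $ j $ k"
  using assoc_coeffs[where i=i and j=j and k=k] by (simp add: comp2_def column_def)

text \<open>\<open>g(x) = F(x,0)\<close> satisfies \<open>g(g(x)) = F(F(x,0),0) = F(x,F(0,0)) = g(x)\<close>.\<close>

lemma F_x_0: "F $ i $ 0 = fps_X $ i"
proof -
  have "fps_comp (column 0) (column 0) = column 0"
  proof (rule fps_ext)
    fix i
    have "fps_comp (column 0) (column 0) $ i = comp2 (column 0) F $ i $ 0"
      by (simp add: fps_comp_def comp2_def at_y_0_power column_def)
    also have "\<dots> = column 0 $ i" unfolding assoc_comp2 by (simp add: comp2_def column_def)
    finally show "fps_comp (column 0) (column 0) $ i = column 0 $ i" .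
  qed
  then have "column 0 = fps_X"
    by (rule comp_idempotent[rotated -1]) (use F_00 F_10 in \<open>simp_all add: column_def\<close>)
  then have "column 0 $ i = fps_X $ i" by simp
  then show ?thesis by (simp add: column_def)
qed

lemma F_0_y: "F $ 0 = fps_X"
proof (rule comp_idempotent)
  show "fps_comp (F $ 0) (F $ 0) = F $ 0"
  proof (rule fps_ext)
    fix k
    have "fps_comp (F $ 0) (F $ 0) $ k = comp2 (F $ 0) F $ 0 $ k"
      by (simp add: fps_comp_def comp2_def power_nth_0)
    also have "\<dots> = F $ 0 $ k" unfolding assoc_comp2[symmetric] by (simp add: comp2_def column_def)
    finally show "fps_comp (F $ 0) (F $ 0) $ k = F $ 0 $ k" .
  qed
qed (use F_00 F_01 in simp_all)

text \<open>The coefficient of \<open>z\<close> in \<open>F(F(x,y),z) = F(x,F(y,z))\<close>, where \<open>F(y,z) = y + p(y) z + \<dots>\<close>.\<close>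

lemma invariant: "fps_Dy F * fps_const (column 1) = comp2 (column 1) F"
proof (intro fps_ext)
  fix i j
  \<comment> \<open>The linear coefficient in \<open>z\<close> of \<open>F(y,z)\<^sup>n\<^sup>+\<^sup>1\<close> is \<open>(n+1) y\<^sup>n p(y)\<close>.\<close>
  have linear: "(F ^ Suc n) $ j $ 1 = nat_mul (Suc n) ((fps_X ^ n * column 1) $ j)" for n
  proof -
    have "(F ^ Suc n) $ j $ 1 = fps_Dy (F ^ Suc n) $ j $ 0" by (simp add: nat_mul_Suc)
    also have "\<dots> = nat_mul (Suc n) ((F ^ n * fps_Dy F) $ j $ 0)"
      by (simp only: fps_Dy_power nat_mul_nth)
    also have "(F ^ n * fps_Dy F) $ j $ 0 = (\<Sum>l=0..j. (F ^ n) $ l $ 0 * column 1 $ (j - l))"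
      by (simp add: fps_mult_nth fps_sum_nth column_def nat_mul_Suc)
    also have "\<dots> = (fps_X ^ n * column 1) $ j"
    proof -
      have "Abs_fps (\<lambda>i. F $ i $ 0) = fps_X" by (rule fps_ext) (simp only: fps_nth_Abs_fps F_x_0)
      then show ?thesis by (simp only: at_y_0_power fps_mult_nth)
    qed
    finally show ?thesis .
  qed
  have "comp2 (column 1) F $ i $ j = (\<Sum>n\<le>Suc j. F $ i $ n * (F ^ n) $ j $ 1)"
    unfolding assoc_comp2 by (simp add: comp2_def)
  also have "\<dots> = (\<Sum>n\<le>j. F $ i $ Suc n * (F ^ Suc n) $ j $ 1)"
    unfolding sum.atMost_Suc_shift by (auto simp: power_0)
  also have "\<dots> = (\<Sum>n\<le>j. fps_D (F $ i) $ n * column 1 $ (j - n))"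
    unfolding linear by (rule sum.cong) (auto simp: X_power_mult_nth nat_mul_mult_left nat_mul_mult_right)
  finally show "(fps_Dy F * fps_const (column 1)) $ i $ j = comp2 (column 1) F $ i $ j"
    by (simp only: fps_mult_right_const_nth fps_Dy_nth) (simp add: fps_mult_nth atLeast0AtMost)
qed

lemma column_1_0: "column 1 $ 0 = 1"
  using F_01 by (simp add: column_def)

subsection \<open>The group of series without constant term\<close>

lemma subst2_nth0: "subst2 F a b $ 0 = 0"
  by (simp add: subst2_nth_0 F_00)

text \<open>Both sides are the value at \<open>(a,b,c)\<close> of the three-variable series with the coefficients that
  associativity identifies; in a fixed degree \<open>K\<close> all sums are finite and may be interchanged.\<close>

lemma subst2_assoc:
  assumes a: "a $ 0 = 0" and b: "b $ 0 = 0" and c: "c $ 0 = 0"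
  shows "subst2 F (subst2 F a b) c = subst2 F a (subst2 F b c)"
proof (rule fps_ext)
  fix K
  let ?d = "subst2 F a b" and ?e = "subst2 F b c"
  let ?A = "\<lambda>i j k. comp2 (column k) F $ i $ j * (a ^ i * b ^ j * c ^ k) $ K"
  have "subst2 F ?d c $ K = (\<Sum>k\<le>K. \<Sum>m\<le>K. F $ m $ k * (?d ^ m * c ^ k) $ K)"
    unfolding subst2_def[of F ?d c] fps_nth_Abs_fps by (rule sum.swap)
  also have "\<dots> = (\<Sum>k\<le>K. (subst2 (comp2 (column k) F) a b * c ^ k) $ K)"
    by (simp add: fps_comp_mult_nth[OF subst2_nth0] column_def subst2_comp2[OF a b F_00])
  also have "\<dots> = (\<Sum>k\<le>K. \<Sum>i\<le>K. \<Sum>j\<le>K. ?A i j k)"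
    by (simp only: subst2_mult_nth[OF a b])
  also have "\<dots> = (\<Sum>i\<le>K. \<Sum>k\<le>K. \<Sum>j\<le>K. ?A i j k)" by (rule sum.swap)
  also have "\<dots> = (\<Sum>i\<le>K. \<Sum>j\<le>K. \<Sum>k\<le>K. ?A i j k)" by (intro sum.cong refl sum.swap)
  also have "\<dots> = (\<Sum>i\<le>K. (subst2 (comp2 (F $ i) F) b c * a ^ i) $ K)"
    by (simp only: subst2_mult_nth[OF b c] assoc_comp2) (simp only: mult_ac)
  also have "\<dots> = subst2 F a ?e $ K"
    by (simp add: subst2_nth_comp[OF subst2_nth0] subst2_comp2[OF b c F_00])
  finally show "subst2 F ?d c $ K = subst2 F a ?e $ K" .
qed

lemma subst2_0_right:
  assumes a: "a $ 0 = 0"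
  shows "subst2 F a 0 = a"
proof -
  have "fps.sums_to (\<lambda>m. fps_const (fps_X $ m) * a ^ m) (subst2 F a 0)"
    using subst2_sums[OF a, of 0 F] by (simp only: fps_comp_0_right F_x_0 fps_zero_nth)
  from fps_comp_eqI[OF a this] show ?thesis by (simp add: fps_comp_X_left a)
qed

lemma subst2_nth_split:
  assumes b: "b $ 0 = 0"
  shows "subst2 F a b $ k = b $ k + (\<Sum>m=1..k. \<Sum>n\<le>k. F $ m $ n * (a ^ m * b ^ n) $ k)"
proof -
  have set: "{..k} = insert 0 {1..k}" by auto
  have "subst2 F a b $ k = fps_comp fps_X b $ k + (\<Sum>m=1..k. \<Sum>n\<le>k. F $ m $ n * (a ^ m * b ^ n) $ k)"
    unfolding subst2_def fps_nth_Abs_fps by (subst set) (simp add: F_0_y fps_comp_def)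
  then show ?thesis by (simp add: fps_comp_X_left b)
qed

lemma subst2_0_left: "b $ 0 = 0 \<Longrightarrow> subst2 F 0 b = b"
  by (rule fps_ext) (simp add: subst2_nth_split power_0_pos)

text \<open>\<open>b \<mapsto> b - F(a,b)\<close> is a contraction, because \<open>F(a,b) = b + \<dots>\<close> with all other terms divisible by \<open>a\<close>.\<close>

lemma right_inverse_exists:
  assumes a: "a $ 0 = 0"
  shows "\<exists>b. b $ 0 = 0 \<and> subst2 F a b = 0"
proof -
  define \<Phi> where "\<Phi> b = Abs_fps (\<lambda>k. if k = 0 then 0 else b $ k - subst2 F a b $ k)" for b :: "'b fps"
  have "\<exists>b. b $ 0 = 0 \<and> \<Phi> b = b"
  proof (rule contraction_fixpoint)
    fix f g :: "'b fps" and N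
    assume f: "f $ 0 = 0" and g: "g $ 0 = 0" and fg: "\<And>k. k < N \<Longrightarrow> f $ k = g $ k"
    have "(a ^ m * f ^ n) $ N = (a ^ m * g ^ n) $ N" if "m \<ge> 1" for m n
    proof (cases n)
      case (Suc l)
      have "a ^ m * (f ^ Suc l - g ^ Suc l) \<in> fps_ideal (m + (N + l))"
        by (rule fps.mult[OF fps.power_mem power_diff_mem]) (simp_all add: fps_ideal_def a f g fg)
      then show ?thesis using that by (simp add: Suc fps_ideal_def right_diff_distrib)
    qed simp
    then show "\<Phi> f $ N = \<Phi> g $ N" by (simp add: \<Phi>_def subst2_nth_split f g)
  qed (simp add: \<Phi>_def)
  then obtain b where b: "b $ 0 = 0" "\<Phi> b = b" by blast
  have "subst2 F a b $ k = 0" for k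
  proof (cases "k = 0")
    case False
    have "b $ k - subst2 F a b $ k = \<Phi> b $ k" using False by (simp add: \<Phi>_def)
    then show ?thesis using b by simp
  qed (simp add: subst2_nth0)
  then have "subst2 F a b = 0" by (intro fps_ext) simp
  with b show ?thesis by blast
qed

text \<open>The usual argument for monoids: if every element has a right inverse, then right inverses are two-sided. Applied
  to \<open>b\<close>, the right inverse \<open>c\<close> of \<open>b\<close> is \<open>a\<close> itself.\<close>

lemma inverse_exists_unique:
  assumes a: "a $ 0 = 0"
  shows "\<exists>!b. b $ 0 = 0 \<and> subst2 F a b = 0 \<and> subst2 F b a = 0"
proof -
  obtain b where b: "b $ 0 = 0" "subst2 F a b = 0" using right_inverse_exists[OF a] by blast
  obtain c where c: "c $ 0 = 0" "subst2 F b c = 0" using right_inverse_exists[OF b(1)] by blast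
  have "c = subst2 F (subst2 F a b) c" by (simp add: b subst2_0_left c)
  also have "\<dots> = a" by (simp add: subst2_assoc a b(1) c subst2_0_right)
  finally have ba: "subst2 F b a = 0" using c by simp
  show ?thesis
  proof (intro ex1I conjI)
    fix b' assume b': "b' $ 0 = 0 \<and> subst2 F a b' = 0 \<and> subst2 F b' a = 0"
    have "b' = subst2 F b' (subst2 F a b)" using b' by (simp add: b subst2_0_right)
    also have "\<dots> = b" using b' by (simp add: a b(1) subst2_0_left flip: subst2_assoc)
    finally show "b' = b" .
  qed (use b ba in auto)
qed

subsection \<open>The logarithm\<close>

lemma log_hom:
  assumes torsion_free: "\<And>n (x::'b). nat_mul (Suc n) x = 0 \<Longrightarrow> x = 0"
    and l: "fps_D l * column 1 = 1" "l $ 0 = 0"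
    and ab: "a $ 0 = 0" "b $ 0 = 0"
  shows "fps_comp l (subst2 F a b) = fps_comp l a + fps_comp l b"
proof -
  have "comp2 l F = comp2 l fps_X + comp2 l (fps_const fps_X)"
    by (rule comp2_additive[OF torsion_free F_x_0 invariant, where w = "fps_D l" and c = 1])
       (use l in \<open>auto simp: mult.commute\<close>)
  then have "subst2 (comp2 l F) a b = subst2 (comp2 l fps_X) a b + subst2 (fps_const l) a b"
    by (simp add: subst2_add comp2_const_X)
  then show ?thesis
    by (simp add: subst2_comp2 ab F_00 subst2_X subst2_const_fps)
qed

end

section \<open>Base change\<close>

locale hom =
  fixes \<phi> :: "'a::{comm_ring, comm_monoid_mult} \<Rightarrow> 'b::{comm_ring, comm_monoid_mult}"
  assumes add: "\<phi> (x + y) = \<phi> x + \<phi> y" and mult: "\<phi> (x * y) = \<phi> x * \<phi> y" and one: "\<phi> 1 = 1"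
begin

lemma zero: "\<phi> 0 = 0"
  using add[of 0 0] by simp

lemma sum: "\<phi> (sum f A) = (\<Sum>i\<in>A. \<phi> (f i))"
  by (induction A rule: infinite_finite_induct) (auto simp: zero add)

lemma prod: "\<phi> (prod f A) = (\<Prod>i\<in>A. \<phi> (f i))"
  by (induction A rule: infinite_finite_induct) (auto simp: one mult)

lemma power: "\<phi> (x ^ n) = \<phi> x ^ n"
  by (induction n) (auto simp: one mult)

lemma uminus: "\<phi> (- x) = - \<phi> x"
  using add[of x "- x"] by (simp add: zero minus_unique)

end

definition fps_map :: "('a \<Rightarrow> 'b) \<Rightarrow> 'a fps \<Rightarrow> 'b fps" where
  "fps_map \<phi> f = Abs_fps (\<lambda>n. \<phi> (f $ n))"

lemma fps_map_nth [simp]: "fps_map \<phi> f $ n = \<phi> (f $ n)"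
  by (simp add: fps_map_def)

lemma fps_map_hom:
  assumes "hom \<phi>"
  shows "hom (fps_map \<phi>)"
proof -
  interpret hom \<phi> by fact
  show ?thesis
  proof
    show "fps_map \<phi> (f * g) = fps_map \<phi> f * fps_map \<phi> g" for f g
      by (rule fps_ext) (simp add: fps_mult_nth sum mult)
  qed (auto intro!: fps_ext simp: add one zero)
qed

lemma subst2_map:
  assumes "hom \<phi>"
  shows "fps_map \<phi> (subst2 F a b) = subst2 (fps_map (fps_map \<phi>) F) (fps_map \<phi> a) (fps_map \<phi> b)"
proof -
  interpret hom \<phi> by fact
  interpret fps: hom "fps_map \<phi>" by (rule fps_map_hom[OF assms])
  show ?thesis
    by (rule fps_ext) (simp add: subst2_def sum mult flip: fps.power fps.mult)
qed

lemma fgl_map: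
  assumes "hom \<phi>" "fgl F"
  shows "fgl (fps_map (fps_map \<phi>) F)"
proof -
  interpret hom \<phi> by fact
  interpret fps2: hom "fps_map (fps_map \<phi>)" by (intro fps_map_hom assms)
  interpret fgl F by fact
  show ?thesis
  proof
    fix i j k
    have "\<phi> (\<Sum>m\<le>i+j. F $ m $ k * (F ^ m) $ i $ j) = \<phi> (\<Sum>n\<le>j+k. F $ i $ n * (F ^ n) $ j $ k)"
      by (simp only: assoc_coeffs)
    then show "(\<Sum>m\<le>i+j. fps_map (fps_map \<phi>) F $ m $ k * (fps_map (fps_map \<phi>) F ^ m) $ i $ j) =
        (\<Sum>n\<le>j+k. fps_map (fps_map \<phi>) F $ i $ n * (fps_map (fps_map \<phi>) F ^ n) $ j $ k)"
      by (simp add: sum mult flip: fps2.power)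
  qed (use F_00 F_10 F_01 in \<open>simp_all add: zero one\<close>)
qed

text \<open>Comparison of the coefficients of \<open>x\<^sup>i y\<^sup>j z\<^sup>k\<close>: a power of the variable that
  stands alone selects one summand.\<close>

lemma formal_group_law_fgl:
  fixes F :: "'a::comm_ring_1 fps fps"
  assumes "formal_group_law F"
  shows "fgl F"
proof -
  let ?Fxy = "Abs_fps (\<lambda>i. Abs_fps (\<lambda>j. fps_const (F $ i $ j))) :: 'a fps fps fps"
  let ?z = "fps_const (fps_const fps_X) :: 'a fps fps fps"
  have const: "hom (fps_const :: 'a \<Rightarrow> 'a fps)" by unfold_locales simp_all
  interpret h: hom "fps_map (fps_map (fps_const :: 'a \<Rightarrow> 'a fps))"
    by (intro fps_map_hom const)
  have Fxy: "?Fxy = fps_map (fps_map fps_const) F" by (simp add: fps_map_def)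
  have assoc: "fgl_add3 F ?Fxy ?z = fgl_add3 F fps_X (fps_const F)"
    and low: "i + j < 2 \<Longrightarrow> F $ i $ j = (fps_X + fps_const fps_X) $ i $ j" for i j
    using assms by (auto simp: formal_group_law_def Let_def)
  have cut: "(\<Sum>m\<le>M. \<Sum>n\<le>N. f m n * (if k = n then g m else 0)) = (\<Sum>m\<le>M. f m k * g m)"
    if "k \<le> N" for M N k :: nat and f and g :: "nat \<Rightarrow> 'a"
    using that by (simp add: mult_delta_right)
  have high: "(F ^ m) $ i $ j = 0" if "i + j < m" for i j m
    using power_nth2_below[of F] low[of 0 0] that by simp
  show ?thesis
  proof
    fix i j k
    have 1: "fgl_add3 F ?Fxy ?z $ i $ j $ k = (\<Sum>m\<le>i+j. F $ m $ k * (F ^ m) $ i $ j)"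
    proof -
      have "(?Fxy ^ m * ?z ^ n) $ i $ j $ k = (if k = n then (F ^ m) $ i $ j else 0)" for m n
        by (simp add: Fxy flip: h.power)
      then have "fgl_add3 F ?Fxy ?z $ i $ j $ k = (\<Sum>m\<le>i+j+k. F $ m $ k * (F ^ m) $ i $ j)"
        by (simp add: fgl_add3_def cut)
      also have "\<dots> = (\<Sum>m\<le>i+j. F $ m $ k * (F ^ m) $ i $ j)"
        by (rule sum.mono_neutral_right) (auto simp: high)
      finally show ?thesis .
    qed
    have 2: "fgl_add3 F fps_X (fps_const F) $ i $ j $ k = (\<Sum>n\<le>j+k. F $ i $ n * (F ^ n) $ j $ k)"
    proof -
      have "(fps_X ^ m * fps_const F ^ n) $ i $ j $ k = (if i = m then (F ^ n) $ j $ k else 0)" for m n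
        by simp
      then have "fgl_add3 F fps_X (fps_const F) $ i $ j $ k =
          (\<Sum>m\<le>i+j+k. \<Sum>n\<le>i+j+k. F $ m $ n * (if i = m then (F ^ n) $ j $ k else 0))"
        by (simp add: fgl_add3_def)
      also have "\<dots> = (\<Sum>n\<le>i+j+k. \<Sum>m\<le>i+j+k. F $ m $ n * (if i = m then (F ^ n) $ j $ k else 0))"
        by (rule sum.swap)
      also have "\<dots> = (\<Sum>n\<le>i+j+k. F $ i $ n * (F ^ n) $ j $ k)"
        by (rule cut) simp
      also have "\<dots> = (\<Sum>n\<le>j+k. F $ i $ n * (F ^ n) $ j $ k)"
        by (rule sum.mono_neutral_right) (auto simp: high)
      finally show ?thesis .
    qed
    show "(\<Sum>m\<le>i+j. F $ m $ k * (F ^ m) $ i $ j) = (\<Sum>n\<le>j+k. F $ i $ n * (F ^ n) $ j $ k)"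
      using assoc by (simp flip: 1 2)
  qed (use low[of 0 0] low[of 1 0] low[of 0 1] in simp_all)
qed

section \<open>Rational coefficients\<close>

text \<open>A constant of its own for \<open>r \<otimes> 1\<close> keeps the simplifier from rewriting the denominator 1 to
  \<open>Suc 0\<close>.\<close>

definition of_R :: "'a::comm_ring_1 \<Rightarrow> 'a rationalization" where
  "of_R r = to_rat r"

lemma of_R_hom: "hom (of_R :: 'a::comm_ring_1 \<Rightarrow> _)"
proof
  fix x y :: 'a
  show "of_R (x + y) = of_R x + of_R y" unfolding of_R_def by (subst rfrac_add) simp_all
  show "of_R (x * y) = of_R x * of_R y" unfolding of_R_def by (subst rfrac_mult) simp_all
  show "of_R (1::'a) = 1" unfolding of_R_def by (rule to_rat_1)
qed

interpretation of_R: hom "of_R :: 'a::comm_ring_1 \<Rightarrow> _"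
  by (rule of_R_hom)

interpretation map_R: hom "fps_map of_R :: 'a::comm_ring_1 fps \<Rightarrow> _"
  by (rule fps_map_hom[OF of_R_hom])

lemma rfrac_eq: "n > 0 \<Longrightarrow> rfrac r n = of_R r * rfrac 1 n"
  unfolding of_R_def by (subst rfrac_mult) simp_all

lemma rfrac_inverse: "n > 0 \<Longrightarrow> of_R (of_nat n) * rfrac 1 n = 1"
  unfolding of_R_def to_rat_1[symmetric] by (subst rfrac_mult) (auto simp: rfrac_eq_iff intro: exI[of _ 1])

lemma nat_mul_eq: "nat_mul n x = of_R (of_nat n) * x"
  by (induction n) (simp_all add: nat_mul_Suc of_R.add of_R.one of_R.zero distrib_right add.commute)

lemma rational_torsion_free:
  fixes x :: "'a::comm_ring_1 rationalization"
  assumes "nat_mul (Suc n) x = 0"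
  shows "x = 0"
proof -
  have "x = (of_R (of_nat (Suc n)) * rfrac 1 (Suc n)) * x" by (subst rfrac_inverse) simp_all
  also have "\<dots> = rfrac 1 (Suc n) * nat_mul (Suc n) x" by (simp only: nat_mul_eq mult_ac)
  finally show ?thesis by (simp add: assms)
qed

lemma rational_fps_torsion_free:
  fixes f :: "'a::comm_ring_1 rationalization fps"
  assumes "nat_mul (Suc n) f = 0"
  shows "f = 0"
proof (rule fps_ext)
  fix k
  have "nat_mul (Suc n) (f $ k) = 0" using assms by (simp flip: nat_mul_nth)
  then show "f $ k = 0 $ k" using rational_torsion_free by auto
qed

lemma fgl_add_eq: "fgl_add F a b = subst2 F a b"
  by (simp add: fgl_add_def subst2_def)

lemma map_R_X: "fps_map of_R fps_X = (fps_X :: 'a::comm_ring_1 rationalization fps)"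
  by (rule fps_ext) (simp add: of_R.zero of_R.one)

lemma fps_to_rat_eq: "fps_to_rat = fps_map of_R"
  by (simp add: fun_eq_iff fps_to_rat_def fps_map_def of_R_def)

locale rational_fgl = R: fgl F for F :: "'a::comm_ring_1 fps fps"
begin

sublocale Q: fgl "fps_map (fps_map of_R) F"
  by (rule fgl_map[OF of_R_hom R.fgl_axioms])

abbreviation "lg \<equiv> fgl_log F"
abbreviation "\<E> \<equiv> fgl_exp F"

lemma log_0: "lg $ 0 = 0"
  by (simp add: fgl_log_def)

lemma log_deriv: "fps_D lg * Q.column 1 = 1"
proof -
  let ?w = "unit_inv (Q.column 1)"
  have p: "Q.column 1 * ?w = 1"
    by (rule fps_unit_inv[of _ 1]) (simp only: Q.column_1_0, simp)
  have log: "lg = Abs_fps (\<lambda>n. if n = 0 then 0 else ?w $ (n - 1) * rfrac 1 n)"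
    by (simp only: fgl_log_def Let_def Q.column_def fps_map_nth of_R_def)
  have "fps_D lg = ?w"
  proof (rule fps_ext)
    fix n
    have "fps_D lg $ n = ?w $ n * (of_R (of_nat (Suc n)) * rfrac 1 (Suc n))"
      by (simp only: log nat_mul_eq fps_D_nth fps_nth_Abs_fps) (simp add: mult_ac)
    also have "\<dots> = ?w $ n" by (subst rfrac_inverse) simp_all
    finally show "fps_D lg $ n = ?w $ n" .
  qed
  with p show ?thesis by (simp only: mult.commute)
qed

lemma log_1: "lg $ 1 = 1"
proof -
  have "(fps_D lg * Q.column 1) $ 0 = 1" by (simp only: log_deriv) simp
  then have "nat_mul (Suc 0) (lg $ 1) * Q.column 1 $ 0 = 1" by simp
  then show ?thesis by (simp only: Q.column_1_0) (simp add: nat_mul_Suc)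
qed

text \<open>A two-sided compositional inverse is unique, by associativity of composition.\<close>

lemma exp_spec: "\<E> $ 0 = 0 \<and> fps_comp lg \<E> = fps_X \<and> fps_comp \<E> lg = fps_X"
proof -
  obtain E where E: "E $ 0 = 0" "fps_comp lg E = fps_X" "fps_comp E lg = fps_X"
    using comp_inverse_exists[of lg 1] log_0 log_1 by auto
  have "\<E> = E" unfolding fgl_exp_def
  proof (rule the_equality)
    fix E' assume E': "E' $ 0 = 0 \<and> fps_comp lg E' = fps_X \<and> fps_comp E' lg = fps_X"
    have "E' = fps_comp (fps_comp E lg) E'" using E' by (simp only: E fps_comp_X_left)
    also have "\<dots> = fps_comp E (fps_comp lg E')" using E' by (simp only: fps_comp_assoc log_0)
    also have "\<dots> = E" using E' by (simp only: fps_comp_X_right)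
    finally show "E' = E" .
  qed (use E in auto)
  with E show ?thesis by simp
qed

lemma exp_1: "\<E> $ 1 = 1"
proof -
  have "fps_comp \<E> lg $ 1 = fps_X $ 1" using exp_spec by simp
  then show ?thesis using log_1 exp_spec by (simp add: fps_comp_def)
qed

lemma log_fgl_add:
  assumes "a $ 0 = 0" "b $ 0 = 0"
  shows "fps_comp lg (fps_map of_R (fgl_add F a b)) =
    fps_comp lg (fps_map of_R a) + fps_comp lg (fps_map of_R b)"
  unfolding fgl_add_eq subst2_map[OF of_R_hom]
  by (rule Q.log_hom[OF rational_torsion_free log_deriv log_0]) (use assms in \<open>simp_all add: of_R.zero\<close>)

lemma mult_nat: "fgl_mult_nat F n $ 0 = 0"
    "fps_comp lg (fps_map of_R (fgl_mult_nat F n)) = fps_const (of_R (of_nat n)) * lg"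
proof (induction n)
  case 0
  show "fgl_mult_nat F 0 $ 0 = 0" by simp
  show "fps_comp lg (fps_map of_R (fgl_mult_nat F 0)) = fps_const (of_R (of_nat 0)) * lg"
    by (simp add: map_R.zero fps_comp_0_right log_0 of_R.zero)
next
  case (Suc n)
  show "fgl_mult_nat F (Suc n) $ 0 = 0" by (simp add: fgl_add_eq R.subst2_nth0)
  show "fps_comp lg (fps_map of_R (fgl_mult_nat F (Suc n))) = fps_const (of_R (of_nat (Suc n))) * lg"
    by (simp add: log_fgl_add Suc map_R_X fps_comp_X_right of_R.add of_R.one distrib_right
        add.commute del: fps_const_add flip: fps_const_add)
qed

lemma inverse_spec:
  assumes "a $ 0 = 0"
  shows "fgl_inverse F a $ 0 = 0" "fgl_add F a (fgl_inverse F a) = 0"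
  using theI'[OF R.inverse_exists_unique[OF assms]]
  by (simp_all add: fgl_inverse_def fgl_add_eq)

lemma mult_0: "fgl_mult F n $ 0 = 0"
  by (simp add: fgl_mult_def mult_nat(1) inverse_spec)

text \<open>For \<open>n < 0\<close> apply \<open>\<ell>\<^sub>F\<close> to \<open>[-n] +\<^sub>F [n] = 0\<close>.\<close>

lemma log_mult: "fps_comp lg (fps_map of_R (fgl_mult F n)) = fps_const (of_R (of_int n)) * lg"
proof (cases "n \<ge> 0")
  case True
  then show ?thesis by (simp add: fgl_mult_def mult_nat(2))
next
  case False
  let ?a = "fgl_mult_nat F (nat (- n))"
  have "fps_comp lg (fps_map of_R ?a) + fps_comp lg (fps_map of_R (fgl_inverse F ?a)) = 0"
    by (simp add: inverse_spec mult_nat(1) map_R.zero fps_comp_0_right log_0 flip: log_fgl_add)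
  moreover have "of_R (of_nat (nat (- n)) :: 'a) = - of_R (of_int n)"
    using False by (simp add: of_R.uminus)
  ultimately have "- (- fps_const (of_R (of_int n)) * lg) = fps_comp lg (fps_map of_R (fgl_inverse F ?a))"
    by (intro minus_unique) (simp only: mult_nat(2) fps_const_neg)
  then show ?thesis using False by (simp add: fgl_mult_def del: fps_const_neg)
qed

definition brac :: "int \<Rightarrow> 'a rationalization fps" where
  "brac n = fps_map of_R (fgl_bracket F n)"

text \<open>Apply \<open>\<E>\<^sub>F\<close> to \<open>\<ell>\<^sub>F([n](t)) = n \<ell>\<^sub>F(t)\<close>.\<close>

lemma X_brac: "fps_X * brac n = fps_comp \<E> (fps_const (of_R (of_int n)) * lg)"
proof -
  have "fps_X * brac n = fps_map of_R (fgl_mult F n)"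
    by (rule fps_ext) (simp add: brac_def fgl_bracket_def mult_0 of_R.zero)
  also have "\<dots> = fps_comp (fps_comp \<E> lg) (fps_map of_R (fgl_mult F n))"
    using exp_spec by (simp add: fps_comp_X_left mult_0 of_R.zero)
  also have "\<dots> = fps_comp \<E> (fps_const (of_R (of_int n)) * lg)"
    by (subst fps_comp_assoc) (simp_all add: log_0 mult_0 of_R.zero log_mult)
  finally show ?thesis .
qed

lemma brac_nth_0: "brac n $ 0 = of_R (of_int n)"
proof -
  have "brac n $ 0 = (fps_X * brac n) $ 1" by simp
  also have "\<dots> = of_R (of_int n)" unfolding X_brac
    using exp_1 log_1 exp_spec by (simp add: fps_comp_def)
  finally show ?thesis .
qed

lemma brac_0: "brac 0 = 0"
  by (rule fps_ext) (simp add: brac_def fgl_bracket_def fgl_mult_def of_R.zero)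

text \<open>Its constant term \<open>n\<close> is invertible.\<close>

lemma brac_unit: "n > 0 \<Longrightarrow> \<exists>c. brac (int n) * c = 1"
  by (rule fps_unit_exists[of _ "rfrac 1 n"]) (simp add: brac_nth_0 rfrac_inverse)


section \<open>The operator \<open>\<nabla>\<close>\<close>

abbreviation x :: "'a rationalization fps fps" where "x \<equiv> 1 + fps_X"
abbreviation x_inv :: "'a rationalization fps fps" where "x_inv \<equiv> unit_inv x"

lemma x_x_inv: "x * x_inv = 1"
  by (rule fps_unit_inv[of _ 1]) simp

end

abbreviation \<theta> where "\<theta> \<equiv> euler_op"

lemma euler_eq: "\<theta> f = (1 + fps_X) * fps_D f"
proof -
  have "fps_const (to_rat (of_nat (n + 1))) * g = nat_mul (Suc n) g"
    for n and g :: "'a::comm_ring_1 rationalization fps"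
    by (rule fps_ext)
       (simp only: fps_mult_left_const_nth nat_mul_nth nat_mul_eq of_R_def Suc_eq_plus1)
  then show ?thesis by (simp only: euler_op_def fps_D_def Suc_eq_plus1)
qed

lemma euler_nth: "\<theta> f $ i = nat_mul (Suc i) (f $ Suc i) + nat_mul i (f $ i)"
  by (cases i) (simp_all add: euler_eq distrib_right)

lemma euler_add: "\<theta> (f + g) = \<theta> f + \<theta> g"
  by (simp add: euler_eq fps_D_add distrib_left)

lemma euler_mult: "\<theta> (f * g) = \<theta> f * g + f * \<theta> g"
  by (simp add: euler_eq fps_D_mult algebra_simps)

lemma euler_const: "\<theta> (fps_const c) = 0"
  by (simp add: euler_eq)

lemma euler_1: "\<theta> 1 = 0"
  using euler_const[of 1] by simp

lemma euler_0: "\<theta> 0 = 0"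
  by (simp add: euler_eq)

lemma euler_pow_add: "(\<theta> ^^ k) (f + g) = (\<theta> ^^ k) f + (\<theta> ^^ k) g"
  by (induction k) (simp_all add: euler_add)

lemma euler_pow_cmult: "(\<theta> ^^ k) (fps_const c * f) = fps_const c * (\<theta> ^^ k) f"
  by (induction k) (simp_all add: euler_mult euler_const)

lemma euler_pow_eigen:
  assumes "\<theta> f = const2 c * f"
  shows "(\<theta> ^^ k) f = const2 (c ^ k) * f"
  by (induction k) (simp_all add: euler_mult euler_const assms flip: mult.assoc, simp add: mult.commute)

text \<open>\<open>\<theta>\<close> acts on each power of \<open>t\<close> separately and raises the exponents of \<open>x -
  1\<close> that are involved by at most one.\<close>

lemma euler_pow_nth_zero:
  assumes "\<And>i'. i' \<le> i + k \<Longrightarrow> f $ i' $ j = 0"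
  shows "(\<theta> ^^ k) f $ i $ j = 0"
  using assms
proof (induction k arbitrary: i)
  case (Suc k)
  then show ?case by (simp add: euler_nth)
qed simp

context rational_fgl
begin

lemma unit_plus_mult: "y * z + y * (c * z) = (1 + c) * (y * z)"
  for y z c :: "'b::{comm_ring, comm_monoid_mult}"
  by (simp add: algebra_simps)

lemma euler_x_power: "\<theta> (x ^ n) = const2 (of_R (of_int (int n))) * x ^ n"
proof (induction n)
  case 0
  show ?case by (simp add: euler_1 of_R.zero)
next
  case (Suc n)
  have x: "\<theta> x = x" by (simp add: euler_eq fps_D_add fps_D_const[of 1, simplified])
  let ?c = "const2 (of_R (of_int (int n) :: 'a))"
  have c: "1 + ?c = const2 (of_R (of_int (int (Suc n))))"
    by (intro fps_ext) (auto simp: of_R.add of_R.one)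
  have "\<theta> (x ^ Suc n) = x * x ^ n + x * (?c * x ^ n)" by (simp only: power_Suc euler_mult x Suc)
  also have "\<dots> = (1 + ?c) * x ^ Suc n"
    using unit_plus_mult[of x "x ^ n" ?c] by (simp only: power_Suc)
  finally show ?case by (simp only: c)
qed

text \<open>\<open>\<theta> (1/x) = - 1/x\<close> follows from \<open>\<theta> (x \<cdot> 1/x) = 0\<close>.\<close>

lemma euler_x_inv_power: "\<theta> (x_inv ^ n) = const2 (of_R (of_int (- int n))) * x_inv ^ n"
proof (induction n)
  case 0
  show ?case by (simp add: euler_1 of_R.zero)
next
  case (Suc n)
  have x: "\<theta> x = x" by (simp add: euler_eq fps_D_add fps_D_const[of 1, simplified])
  have "x_inv * \<theta> (x * x_inv) = 0" by (simp add: x_x_inv euler_1)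
  then have "(x * x_inv) * x_inv + (x * x_inv) * \<theta> x_inv = 0"
    by (simp only: euler_mult x distrib_left mult_ac)
  then have "x_inv + \<theta> x_inv = 0" by (simp only: x_x_inv mult_1_left)
  from minus_unique[OF this] have xi: "\<theta> x_inv = - x_inv" by (rule sym)
  let ?c = "const2 (of_R (of_int (- int n) :: 'a))"
  have "of_int (- int (Suc n)) = of_int (- int n) + (- 1 :: 'a)" by simp
  then have c: "- 1 + ?c = const2 (of_R (of_int (- int (Suc n))))"
    by (intro fps_ext) (simp only: of_R.add of_R.uminus of_R.one, simp)
  have "\<theta> (x_inv ^ Suc n) = - x_inv * x_inv ^ n + x_inv * (?c * x_inv ^ n)"
    by (simp only: power_Suc euler_mult xi Suc)
  also have "\<dots> = (- 1 + ?c) * x_inv ^ Suc n"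
    by (simp only: power_Suc mult.left_commute[of x_inv ?c] distrib_right mult_minus_left mult_1_left)
  finally show ?case by (simp only: c)
qed

abbreviation "\<Lambda> \<equiv> exp_log_euler F"

lemma log_power_mem: "lg ^ k * f \<in> fps_ideal k"
  by (rule fps.ideal_right[OF fps.power_mem]) (simp add: fps_ideal_1 log_0)

lemma exp_log_euler_sums: "fps.sums_to (\<lambda>k. fps_const (\<E> $ k) * (lg ^ k * (\<theta> ^^ k) f $ i)) (\<Lambda> f $ i)"
  unfolding fps.sums_to_def
proof
  fix N
  have "\<Lambda> f $ i $ j = (\<Sum>k<N. \<E> $ k * (lg ^ k * (\<theta> ^^ k) f $ i) $ j)" if j: "j < N" for j
    unfolding exp_log_euler_def fps_nth_Abs_fps
  proof (rule sum.mono_neutral_left)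
    show "\<forall>k\<in>{..<N} - {..j}. \<E> $ k * (lg ^ k * (\<theta> ^^ k) f $ i) $ j = 0"
      using log_power_mem[of _ "(\<theta> ^^ _) f $ i"] by (auto simp: fps_ideal_def)
  qed (use j in auto)
  then show "\<Lambda> f $ i - (\<Sum>k<N. fps_const (\<E> $ k) * (lg ^ k * (\<theta> ^^ k) f $ i)) \<in> fps_ideal N"
    by (simp add: fps_ideal_def fps_sum_nth)
qed

lemma Lambda_add: "\<Lambda> (f + g) = \<Lambda> f + \<Lambda> g"
  by (intro fps_ext) (simp add: exp_log_euler_def euler_pow_add distrib_left sum.distrib)

lemma Lambda_cmult: "\<Lambda> (fps_const c * f) = fps_const c * \<Lambda> f"
proof (rule fps_ext)
  fix i
  have "fps.sums_to (\<lambda>k. c * (fps_const (\<E> $ k) * (lg ^ k * (\<theta> ^^ k) f $ i))) (c * \<Lambda> f $ i)"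
    by (rule sums_to_hom[OF fps.filtration_axioms fps.filtration_axioms _ _ exp_log_euler_sums])
       (auto simp: distrib_left intro: fps.ideal_left)
  then have "fps.sums_to (\<lambda>k. fps_const (\<E> $ k) * (lg ^ k * (\<theta> ^^ k) (fps_const c * f) $ i)) (c * \<Lambda> f $ i)"
    by (simp only: euler_pow_cmult fps_mult_left_const_nth mult.left_commute)
  then show "\<Lambda> (fps_const c * f) $ i = (fps_const c * \<Lambda> f) $ i"
    using fps.sums_to_unique[OF exp_log_euler_sums] by (simp only: fps_mult_left_const_nth)
qed

text \<open>On an eigenvector with eigenvalue \<open>c\<close>, the operator \<open>\<E>\<^sub>F(\<ell>\<^sub>F
  \<theta>)\<close> acts as \<open>\<E>\<^sub>F(c \<ell>\<^sub>F)\<close>.\<close>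

lemma Lambda_eigen:
  assumes "\<theta> f = const2 c * f"
  shows "\<Lambda> f = fps_const (fps_comp \<E> (fps_const c * lg)) * f"
proof -
  have "(fps_const c * lg) $ 0 = 0" by (simp add: log_0)
  then show ?thesis
    by (intro fps_ext)
       (simp only: exp_log_euler_def fps_nth_Abs_fps euler_pow_eigen[OF assms] fps_mult_left_const_nth
          fps_comp_mult_nth power_mult_distrib const_power, simp only: mult_ac)
qed

lemma Lambda_nth_0: "\<Lambda> f $ i $ 0 = 0"
  using exp_spec by (simp add: exp_log_euler_def)

text \<open>\<open>\<nabla> f\<close> is determined by \<open>t x \<nabla> f = \<E>\<^sub>F(\<ell>\<^sub>F \<theta>)
  f\<close>. This form is easier to use than division by \<open>t\<close>, which is a shift.\<close>

lemma nabla_eqI: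
  assumes "\<And>i. \<Lambda> f $ i = fps_X * g $ i"
  shows "nabla F f = x_inv * g"
proof -
  have "Abs_fps (\<lambda>i. fps_shift 1 (\<Lambda> f $ i)) = g"
    by (intro fps_ext) (simp add: assms)
  then show ?thesis by (simp add: nabla_def)
qed

lemma Lambda_nabla: "\<Lambda> f $ i = fps_X * (x * nabla F f) $ i"
proof -
  have "x * nabla F f = (x * x_inv) * Abs_fps (\<lambda>i. fps_shift 1 (\<Lambda> f $ i))"
    by (simp only: nabla_def mult.assoc)
  also have "\<dots> = Abs_fps (\<lambda>i. fps_shift 1 (\<Lambda> f $ i))" by (simp only: x_x_inv mult_1_left)
  finally have "x * nabla F f = Abs_fps (\<lambda>i. fps_shift 1 (\<Lambda> f $ i))" .
  then show ?thesis by (intro fps_ext) (simp add: Lambda_nth_0)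
qed

lemma x_inv_x_mult: "x_inv * (x * f) = f"
  by (simp add: x_x_inv mult.commute[of x_inv x] flip: mult.assoc)

lemma nabla_add: "nabla F (f + g) = nabla F f + nabla F g"
proof -
  have "nabla F (f + g) = x_inv * (x * nabla F f + x * nabla F g)"
    by (rule nabla_eqI) (simp only: Lambda_add fps_add_nth Lambda_nabla distrib_left)
  then show ?thesis by (simp only: distrib_left x_inv_x_mult)
qed

lemma nabla_cmult: "nabla F (fps_const c * f) = fps_const c * nabla F f"
proof -
  have "nabla F (fps_const c * f) = x_inv * (fps_const c * (x * nabla F f))"
    by (rule nabla_eqI) (simp only: Lambda_cmult fps_mult_left_const_nth Lambda_nabla mult.left_commute)
  also have "\<dots> = fps_const c * (x_inv * (x * nabla F f))" by (simp only: mult.left_commute)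
  finally show ?thesis by (simp only: x_inv_x_mult)
qed

lemma nabla_0: "nabla F 0 = 0"
  using nabla_add[of 0 0] by simp

lemma nabla_sum: "nabla F (sum f A) = (\<Sum>i\<in>A. nabla F (f i))"
  by (induction A rule: infinite_finite_induct) (simp_all add: nabla_0 nabla_add)

lemma nabla_diff: "nabla F (f - g) = nabla F f - nabla F g"
  using nabla_add[of "f - g" g] by simp

lemma nabla_eigen:
  assumes "\<theta> f = const2 (of_R (of_int n)) * f"
  shows "nabla F f = fps_const (brac n) * (x_inv * f)"
proof -
  have "nabla F f = x_inv * (fps_const (brac n) * f)"
    by (rule nabla_eqI) (simp add: Lambda_eigen[OF assms] mult.assoc flip: X_brac)
  then show ?thesis by (simp only: mult.left_commute)
qed

lemma nabla_x_power: "nabla F (x ^ n) = fps_const (brac (int n)) * x ^ (n - 1)"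
  unfolding nabla_eigen[OF euler_x_power] by (cases n) (simp add: brac_0, simp only: power_Suc x_inv_x_mult, simp)

lemma nabla_x_inv_power: "nabla F (x_inv ^ n) = fps_const (brac (- int n)) * x_inv ^ Suc n"
  unfolding nabla_eigen[OF euler_x_inv_power] by simp

section \<open>The function \<open>F log\<close>\<close>

abbreviation logx :: "'a rationalization fps fps" where
  "logx \<equiv> Abs_fps (\<lambda>n. fps_const (log_series $ n))"

lemma euler_logx: "\<theta> logx = 1"
proof -
  have "fps_D logx = Abs_fps (\<lambda>n. fps_const (of_R ((- 1) ^ n)))"
  proof (intro fps_ext)
    fix n k
    have "of_R (of_nat (Suc n)) * rfrac ((- 1) ^ (Suc n + 1)) (Suc n) =
        of_R ((- 1) ^ n :: 'a) * (of_R (of_nat (Suc n)) * rfrac 1 (Suc n))"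
      by (subst rfrac_eq) (simp_all add: mult_ac)
    also have "\<dots> = of_R ((- 1) ^ n)" by (subst rfrac_inverse) simp_all
    finally have "of_R (of_nat (Suc n)) * rfrac ((- 1) ^ (Suc n + 1)) (Suc n) = of_R ((- 1) ^ n :: 'a)" .
    then show "fps_D logx $ n $ k = Abs_fps (\<lambda>n. fps_const (of_R ((- 1) ^ n))) $ n $ k"
      by (simp only: fps_D_nth fps_nth_Abs_fps nat_mul_nth nat_mul_eq log_series_def) simp
  qed
  moreover have "(1 + fps_X) * Abs_fps (\<lambda>n. fps_const (of_R ((- 1) ^ n :: 'a))) = 1"
  proof (rule fps_ext)
    fix n
    show "((1 + fps_X) * Abs_fps (\<lambda>n. fps_const (of_R ((- 1) ^ n :: 'a)))) $ n = 1 $ n"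
      by (cases n) (simp_all add: distrib_right of_R.one of_R.uminus)
  qed
  ultimately show ?thesis by (simp only: euler_eq)
qed

text \<open>\<open>t/\<ell>\<^sub>F(t)\<close>.\<close>

definition log_scale :: "'a rationalization fps" where
  "log_scale = unit_inv (fps_shift 1 lg)"

lemma log_scale: "fps_shift 1 lg * log_scale = 1"
  unfolding log_scale_def by (rule fps_unit_inv[of _ 1]) (use log_1 in simp)

lemma Flog_eq: "Flog F = fps_const log_scale * logx"
  by (simp add: Flog_def log_scale_def)

lemma Flog_nth_0: "Flog F $ 0 = 0"
  by (simp add: Flog_eq log_series_def)

text \<open>Because \<open>\<theta>\<^sup>k log x = 0\<close> for \<open>k \<ge> 2\<close> and \<open>\<E>\<^sub>F\<close>
  has no constant term, \<open>\<E>\<^sub>F(\<ell>\<^sub>F \<theta>)\<close> maps \<open>log x\<close> to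
  \<open>\<ell>\<^sub>F(t)\<close>, which the factor \<open>t/\<ell>\<^sub>F(t)\<close> turns into \<open>t\<close>.\<close>

lemma nabla_Flog: "nabla F (Flog F) = x_inv"
proof -
  have high: "(\<theta> ^^ Suc (Suc k)) logx = 0" for k
    by (induction k) (simp_all add: euler_logx euler_1 euler_0)
  have "\<Lambda> logx = fps_const lg"
  proof (intro fps_ext)
    fix i j
    have "\<Lambda> logx $ i $ j = (\<Sum>k\<in>{1} \<inter> {..j}. \<E> $ k * (lg ^ k * (\<theta> ^^ k) logx $ i) $ j)"
      unfolding exp_log_euler_def fps_nth_Abs_fps
    proof (rule sum.mono_neutral_right)
      have "\<E> $ k * (lg ^ k * (\<theta> ^^ k) logx $ i) $ j = 0" if "k \<noteq> 1" for k
      proof (cases "k = 0")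
        case False
        with that obtain m where "k = Suc (Suc m)" by (metis One_nat_def not0_implies_Suc)
        then show ?thesis by (simp only: high) simp
      qed (use exp_spec in simp)
      then show "\<forall>k\<in>{..j} - {1} \<inter> {..j}. \<E> $ k * (lg ^ k * (\<theta> ^^ k) logx $ i) $ j = 0" by auto
    qed auto
    also have "\<dots> = fps_const lg $ i $ j"
      using exp_1 log_0 by (cases j) (auto simp: euler_logx)
    finally show "\<Lambda> logx $ i $ j = fps_const lg $ i $ j" .
  qed
  then have "nabla F logx = x_inv * fps_const (fps_shift 1 lg)"
    by (intro nabla_eqI fps_ext) (auto simp: log_0)
  then have "nabla F (Flog F) = x_inv * fps_const (fps_shift 1 lg * log_scale)"
    by (simp only: Flog_eq nabla_cmult fps_const_mult[symmetric] mult_ac)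
  then show ?thesis by (simp only: log_scale) simp
qed

text \<open>\<open>p = 1 + u\<close> is invariant under the multiplicative group law \<open>u + v + u v\<close>, in which
  \<open>1 + u\<close> and \<open>1 + v\<close> are multiplied, and \<open>(1 + u) \<partial>\<^sub>u F log\<close> is constant.\<close>

lemma Flog_mult:
  "fps_at2 (Flog F) (var_x * var_y) = fps_at2 (Flog F) var_x + fps_at2 (Flog F) var_y"
proof -
  let ?G = "fps_X + fps_const fps_X + fps_X * fps_const fps_X :: 'a rationalization fps fps fps"
  have at2: "fps_at2 f q = comp2 f (q - 1)" for f :: "'a rationalization fps fps" and q
    by (simp add: fps_at2_def comp2_def)
  have "comp2 (Flog F) ?G = comp2 (Flog F) fps_X + comp2 (Flog F) (fps_const fps_X)"
  proof (rule comp2_additive[OF rational_fps_torsion_free])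
    show "?G $ i $ 0 = fps_X $ i" for i by simp
    have "comp2 x ?G = 1 + ?G"
      using comp2_add[of 1 fps_X ?G] comp2_const[of 1 ?G] by (simp add: comp2_X_left)
    then show "fps_Dy ?G * fps_const x = comp2 x ?G"
      by (simp add: fps_Dy_add fps_Dy_mult fps_Dy_X algebra_simps flip: fps_const_add)
    show "x * x_inv = 1" by (rule x_x_inv)
    have "fps_D logx * x = 1" using euler_logx by (simp only: euler_eq mult.commute)
    then show "fps_D (Flog F) * x = fps_const log_scale"
      by (simp add: Flog_eq fps_D_mult mult.assoc)
    show "Flog F $ 0 = 0" by (rule Flog_nth_0)
  qed
  moreover have "var_x * var_y - 1 = ?G" "var_x - 1 = (fps_X :: 'a rationalization fps fps fps)"
    "var_y - 1 = (fps_const fps_X :: 'a rationalization fps fps fps)"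
    by (simp_all add: var_x_def var_y_def algebra_simps)
  ultimately show ?thesis by (simp only: at2)
qed

section \<open>Taylor expansion\<close>

text \<open>
  In \<open>t x \<nabla> f = \<Lambda> f = \<Sum>\<^sub>k e\<^sub>k \<ell>\<^sup>k \<theta>\<^sup>k f\<close> the term \<open>k = 1\<close> contributes \<open>t \<theta> f\<close>, and everything else involves only
  coefficients of \<open>f\<close> with a smaller exponent of \<open>t\<close> and of no larger total degree. So the
  coefficients of \<open>\<theta> f\<close>, hence those of \<open>f\<close>, vanish by induction on the exponent of \<open>t\<close>.
\<close>

lemma nabla_raises_order:
  assumes f0: "f $ 0 = 0" and nabla: "nabla F f \<in> fps2_ideal N"
  shows "f \<in> fps2_ideal (Suc N)"
proof -
  have Lambda: "\<Lambda> f $ i $ Suc j = 0" if "i + j < N" for i j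
    using fps2.ideal_left[OF nabla, of x] that unfolding Lambda_nabla by (auto simp: fps2_ideal_def)
  have "\<forall>i. i + j \<le> N \<longrightarrow> f $ i $ j = 0" for j
  proof (induction j rule: less_induct)
    case (less j)
    \<comment> \<open>As \<open>\<ell>\<^sup>k\<close> starts with \<open>t\<^sup>k\<close>, the coefficients of \<open>t\<^sup>j\<close> in \<open>f\<close> enter only for \<open>k = 1\<close>, through \<open>t \<theta> f\<close>.\<close>
    have terms: "\<E> $ k * (lg ^ k * (\<theta> ^^ k) f $ i) $ Suc j = (if k = 1 then \<theta> f $ i $ j else 0)"
      if ij: "i + j < N" for i k
    proof (cases "k = 0")
      case k: False
      let ?g = "(\<theta> ^^ k) f $ i"
      have z: "(lg ^ k) $ a * ?g $ (Suc j - a) = 0" if a: "a \<le> Suc j" "\<not> (k = 1 \<and> a = 1)" for a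
      proof (cases "a < k")
        case False
        then have "f $ i' $ (Suc j - a) = 0" if "i' \<le> i + k" for i'
          using less.IH[of "Suc j - a"] a k that ij by auto
        then show ?thesis by (simp add: euler_pow_nth_zero)
      qed (simp add: power_nth_below log_0)
      show ?thesis
      proof (cases "k = 1")
        case True
        have "(lg ^ k * ?g) $ Suc j = (\<Sum>a\<in>{1}. (lg ^ k) $ a * ?g $ (Suc j - a))"
          unfolding fps_mult_nth by (rule sum.mono_neutral_right) (use True z in auto)
        then show ?thesis using True log_1 exp_1 by simp
      next
        case False
        then have "(lg ^ k * ?g) $ Suc j = 0"
          unfolding fps_mult_nth by (intro sum.neutral) (use z in auto)
        then show ?thesis using False by simp
      qed
    qed (use exp_spec in simp)
    have theta: "\<theta> f $ i $ j = 0" if "i + j < N" for i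
      using Lambda[OF that] terms[OF that] by (simp add: exp_log_euler_def split: if_splits)
    have "i + j \<le> N \<longrightarrow> f $ i $ j = 0" for i
    proof (induction i)
      case (Suc i)
      show ?case
      proof
        assume "Suc i + j \<le> N"
        then have "nat_mul (Suc i) (f $ Suc i $ j) = 0"
          using theta[of i] Suc by (simp add: euler_nth)
        then show "f $ Suc i $ j = 0" by (rule rational_torsion_free)
      qed
    qed (simp add: f0)
    then show ?case by blast
  qed
  then show ?thesis by (auto simp: fps2_ideal_def)
qed

text \<open>Each application of \<open>nabla_raises_order\<close> gains one order, beginning with \<open>\<nabla>\<^sup>N
  f\<close>, which vanishes at \<open>x = 1\<close>.\<close>

lemma taylor_zero:
  assumes "\<And>m. m \<le> N \<Longrightarrow> (nabla F ^^ m) f $ 0 = 0"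
  shows "f \<in> fps2_ideal (Suc N)"
  using assms
proof (induction N arbitrary: f)
  case 0
  from "0"[of 0] show ?case by (simp add: fps2_ideal_def)
next
  case (Suc N)
  have "nabla F f \<in> fps2_ideal (Suc N)"
  proof (rule Suc.IH)
    fix m assume "m \<le> N"
    then show "(nabla F ^^ m) (nabla F f) $ 0 = 0" using Suc.prems[of "Suc m"] by (simp add: funpow_swap1)
  qed
  then show ?case using nabla_raises_order Suc.prems[of 0] by simp
qed

end

section \<open>Fractions\<close>

lemma tfrac_add:
  assumes "non_zero_divisor s" "non_zero_divisor u"
  shows "tfrac a s + tfrac b u = tfrac (a * u + b * s) (s * u)"
  using assms
proof transfer
  fix s u a b :: 'a assume "non_zero_divisor s" "non_zero_divisor u"
  then show "loc_rel (Collect non_zero_divisor)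
      (frac_add (if non_zero_divisor s then (a, s) else (0, 1)) (if non_zero_divisor u then (b, u) else (0, 1)))
      (if non_zero_divisor (s * u) then (a * u + b * s, s * u) else (0, 1))"
    by (intro loc_relI submonoid_nzd) (simp_all add: frac_add_def non_zero_divisor_mult)
qed

lemma tfrac_mult:
  assumes "non_zero_divisor s" "non_zero_divisor u"
  shows "tfrac a s * tfrac b u = tfrac (a * b) (s * u)"
  using assms
proof transfer
  fix s u a b :: 'a assume "non_zero_divisor s" "non_zero_divisor u"
  then show "loc_rel (Collect non_zero_divisor)
      (frac_mult (if non_zero_divisor s then (a, s) else (0, 1)) (if non_zero_divisor u then (b, u) else (0, 1)))
      (if non_zero_divisor (s * u) then (a * b, s * u) else (0, 1))"
    by (intro loc_relI submonoid_nzd) (simp_all add: frac_mult_def non_zero_divisor_mult)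
qed

lemma tfrac_0: "tfrac 0 1 = 0"
  by transfer (simp add: loc_rel_refl submonoid_nzd non_zero_divisor_1)

lemma tfrac_1: "tfrac 1 1 = 1"
  by transfer (simp add: loc_rel_refl submonoid_nzd non_zero_divisor_1)

locale torsion_free_fgl = rational_fgl F for F :: "'a::comm_ring_1 fps fps" +
  assumes mult_nzd: "n > 0 \<Longrightarrow> non_zero_divisor (fgl_mult F n)"
begin

lemma bracket_nzd: "n > 0 \<Longrightarrow> non_zero_divisor (fgl_bracket F n)"
proof -
  assume n: "n > 0"
  have X: "fps_X * fgl_bracket F n = fgl_mult F n"
    by (rule fps_ext) (simp add: fgl_bracket_def mult_0)
  show ?thesis unfolding non_zero_divisor_def
  proof (intro allI impI)
    fix c assume "fgl_bracket F n * c = 0"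
    then have "fgl_mult F n * c = 0" by (simp add: mult.assoc flip: X)
    then show "c = 0" using mult_nzd[OF n] by (auto simp: non_zero_divisor_def)
  qed
qed

abbreviation M :: "'a fps set" where "M \<equiv> bracket_monoid F"

lemma M_1: "1 \<in> M"
  unfolding bracket_monoid_def by (rule CollectI, rule exI[of _ "[]"]) simp

lemma M_mult: "s \<in> M \<Longrightarrow> u \<in> M \<Longrightarrow> s * u \<in> M"
proof -
  assume "s \<in> M" "u \<in> M"
  then obtain ks js where
    "s = prod_list (map (fgl_bracket F \<circ> int) ks)" "\<forall>i\<in>set ks. i \<ge> 1"
    "u = prod_list (map (fgl_bracket F \<circ> int) js)" "\<forall>i\<in>set js. i \<ge> 1"
    by (auto simp: bracket_monoid_def)
  then show ?thesis unfolding bracket_monoid_def by (intro CollectI exI[of _ "ks @ js"]) auto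
qed

lemma M_bracket: "i > 0 \<Longrightarrow> fgl_bracket F (int i) \<in> M"
  unfolding bracket_monoid_def by (rule CollectI, rule exI[of _ "[i]"]) simp

lemma M_fact: "fgl_fact F n \<in> M"
proof (induction n)
  case (Suc n)
  then show ?case using M_mult[OF Suc M_bracket[of "Suc n"]] by (simp add: fgl_fact_def)
qed (simp add: fgl_fact_def M_1)

text \<open>Both parts hold for the generators: \<open>\<langle>i\<rangle>\<^sub>F\<close> divides
  \<open>[i]\<^sub>F(t)\<close>, and over \<open>R \<otimes> \<rat>\<close> its constant term is invertible. So fractions
  with denominator in \<open>M\<close> have their usual meaning and map to \<open>(R \<otimes> \<rat>)[[t]]\<close>.\<close>

lemma M_nzd_unit: "s \<in> M \<Longrightarrow> non_zero_divisor s \<and> (\<exists>c. fps_map of_R s * c = 1)"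
proof -
  have "non_zero_divisor (prod_list (map (fgl_bracket F \<circ> int) ks)) \<and>
      (\<exists>c. fps_map of_R (prod_list (map (fgl_bracket F \<circ> int) ks)) * c = 1)"
    if "\<forall>i\<in>set ks. i \<ge> 1" for ks :: "nat list"
    using that
  proof (induction ks)
    case (Cons i ks)
    let ?b = "fgl_bracket F (int i)" and ?p = "prod_list (map (fgl_bracket F \<circ> int) ks)"
    have "\<forall>j\<in>set ks. j \<ge> 1" using Cons.prems by simp
    from Cons.IH[OF this] obtain c where p: "non_zero_divisor ?p" "fps_map of_R ?p * c = 1" by blast
    obtain d where d: "fps_map of_R ?b * d = 1"
      using brac_unit[of i] Cons.prems by (auto simp: brac_def)
    have "fps_map of_R (?b * ?p) * (c * d) = (fps_map of_R ?p * c) * (fps_map of_R ?b * d)"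
      by (simp only: map_R.mult mult_ac)
    then have "fps_map of_R (?b * ?p) * (c * d) = 1" by (simp only: p d mult_1_left)
    moreover have "non_zero_divisor (?b * ?p)"
      using Cons.prems by (intro non_zero_divisor_mult bracket_nzd p) simp
    moreover have "prod_list (map (fgl_bracket F \<circ> int) (i # ks)) = ?b * ?p" by simp
    ultimately show ?case by metis
  qed (auto simp: non_zero_divisor_1 map_R.one intro: exI[of _ 1])
  moreover assume "s \<in> M"
  ultimately show ?thesis by (auto simp: bracket_monoid_def)
qed

lemma M_nzd: "s \<in> M \<Longrightarrow> non_zero_divisor s"
  using M_nzd_unit by blast

abbreviation A :: "'a fps total_fract set" where "A \<equiv> fgl_loc F"

lemma A_tfrac: "s \<in> M \<Longrightarrow> tfrac a s \<in> A"
  by (auto simp: fgl_loc_def)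

lemma A_cases: assumes "z \<in> A" obtains a s where "s \<in> M" "z = tfrac a s"
  using assms by (auto simp: fgl_loc_def)

lemma A_add: "z \<in> A \<Longrightarrow> w \<in> A \<Longrightarrow> z + w \<in> A"
  by (elim A_cases) (simp add: tfrac_add M_nzd A_tfrac M_mult)

lemma A_mult: "z \<in> A \<Longrightarrow> w \<in> A \<Longrightarrow> z * w \<in> A"
  by (elim A_cases) (simp add: tfrac_mult M_nzd A_tfrac M_mult)

lemma A_0: "0 \<in> A" and A_1: "1 \<in> A"
  using A_tfrac[OF M_1, of 0] A_tfrac[OF M_1, of 1] by (simp_all add: tfrac_0 tfrac_1)

lemma A_minus_1: "- 1 \<in> A"
proof -
  have "tfrac (- 1) 1 + tfrac 1 1 = (0 :: 'a fps total_fract)"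
    by (simp add: tfrac_add non_zero_divisor_1 tfrac_0)
  then have "tfrac (- 1) (1 :: 'a fps) = - 1"
    by (simp add: tfrac_1 eq_neg_iff_add_eq_0)
  then show ?thesis using A_tfrac[OF M_1, of "- 1"] by simp
qed

lemma A_uminus: "z \<in> A \<Longrightarrow> - z \<in> A"
  using A_mult[OF A_minus_1] by simp

lemma A_sum: "(\<And>i. i \<in> I \<Longrightarrow> f i \<in> A) \<Longrightarrow> sum f I \<in> A"
  by (induction I rule: infinite_finite_induct) (auto simp: A_0 A_add)

lemma A_power: "z \<in> A \<Longrightarrow> z ^ n \<in> A"
  by (induction n) (auto simp: A_1 A_mult)

subsection \<open>The map to rational coefficients\<close>

lemma loc_to_rat_eqI:
  assumes s: "s \<in> M" and c: "c * fps_map of_R s = fps_map of_R a"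
  shows "loc_to_rat F (tfrac a s) = c"
  unfolding loc_to_rat_def fps_to_rat_eq
proof (rule the_equality)
  fix c' assume "\<exists>b. \<exists>u\<in>M. tfrac a s = tfrac b u \<and> c' * fps_map of_R u = fps_map of_R b"
  then obtain b u where u: "u \<in> M" "a * u = b * s" "c' * fps_map of_R u = fps_map of_R b"
    using s by (auto simp: tfrac_eq_iff M_nzd)
  obtain d where d: "fps_map of_R s * d = 1" using M_nzd_unit[OF s] by blast
  obtain e where e: "fps_map of_R u * e = 1" using M_nzd_unit[OF u(1)] by blast
  have "fps_map of_R a * fps_map of_R u = fps_map of_R b * fps_map of_R s"
    using u(2) by (simp flip: map_R.mult)
  then have "c * fps_map of_R s * fps_map of_R u * (d * e) = c' * fps_map of_R u * fps_map of_R s * (d * e)"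
    by (simp only: c u(3))
  then have "c * (fps_map of_R s * d) * (fps_map of_R u * e) = c' * (fps_map of_R s * d) * (fps_map of_R u * e)"
    by (simp only: mult_ac)
  then show "c' = c" by (simp add: d e)
qed (use s c in blast)

text \<open>The defining property of the image of a fraction, from which the ring homomorphism laws follow.\<close>

lemma loc_to_rat_mult_denominator:
  assumes s: "s \<in> M"
  shows "loc_to_rat F (tfrac a s) * fps_map of_R s = fps_map of_R a"
proof -
  obtain d where d: "fps_map of_R s * d = 1" using M_nzd_unit[OF s] by blast
  have "fps_map of_R a * d * fps_map of_R s = fps_map of_R a * (fps_map of_R s * d)"
    by (simp only: mult_ac)
  then have "fps_map of_R a * d * fps_map of_R s = fps_map of_R a" by (simp add: d)
  with loc_to_rat_eqI[OF s this] show ?thesis by simp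
qed

lemma loc_to_rat_tfrac_1: "loc_to_rat F (tfrac a 1) = fps_map of_R a"
  by (rule loc_to_rat_eqI[OF M_1]) (simp add: map_R.one)

lemma loc_to_rat_0: "loc_to_rat F 0 = 0" and loc_to_rat_1: "loc_to_rat F 1 = 1"
  using loc_to_rat_tfrac_1[of 0] loc_to_rat_tfrac_1[of 1]
  by (simp_all add: tfrac_0 tfrac_1 map_R.zero map_R.one)

lemma loc_to_rat_add:
  assumes "z \<in> A" "w \<in> A"
  shows "loc_to_rat F (z + w) = loc_to_rat F z + loc_to_rat F w"
proof -
  obtain a s where s: "s \<in> M" "z = tfrac a s" using assms(1) by (rule A_cases)
  obtain b u where u: "u \<in> M" "w = tfrac b u" using assms(2) by (rule A_cases)
  have "(loc_to_rat F z + loc_to_rat F w) * (fps_map of_R s * fps_map of_R u) =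
      (loc_to_rat F z * fps_map of_R s) * fps_map of_R u + (loc_to_rat F w * fps_map of_R u) * fps_map of_R s"
    by (simp add: algebra_simps)
  then show ?thesis
    by (simp add: s u tfrac_add M_nzd M_mult loc_to_rat_mult_denominator loc_to_rat_eqI map_R.add map_R.mult)
qed

lemma loc_to_rat_mult:
  assumes "z \<in> A" "w \<in> A"
  shows "loc_to_rat F (z * w) = loc_to_rat F z * loc_to_rat F w"
proof -
  obtain a s where s: "s \<in> M" "z = tfrac a s" using assms(1) by (rule A_cases)
  obtain b u where u: "u \<in> M" "w = tfrac b u" using assms(2) by (rule A_cases)
  have "(loc_to_rat F z * loc_to_rat F w) * (fps_map of_R s * fps_map of_R u) =
      (loc_to_rat F z * fps_map of_R s) * (loc_to_rat F w * fps_map of_R u)"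
    by (simp only: mult_ac)
  then show ?thesis
    by (simp add: s u tfrac_mult M_nzd M_mult loc_to_rat_mult_denominator loc_to_rat_eqI map_R.mult)
qed

lemma loc_to_rat_sum:
  "(\<And>i. i \<in> I \<Longrightarrow> f i \<in> A) \<Longrightarrow> loc_to_rat F (sum f I) = (\<Sum>i\<in>I. loc_to_rat F (f i))"
  by (induction I rule: infinite_finite_induct) (auto simp: loc_to_rat_0 loc_to_rat_add A_sum)

section \<open>The polynomials \<open>(x + y)\<^sup>n\<^sub>s\<close>\<close>

abbreviation br :: "nat \<Rightarrow> 'a fps total_fract" where
  "br i \<equiv> tfrac (fgl_bracket F (int i)) 1"

definition br_inv :: "nat \<Rightarrow> 'a fps total_fract" where
  "br_inv i = tfrac 1 (fgl_bracket F (int i))"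

lemma br_A: "br i \<in> A"
  by (rule A_tfrac[OF M_1])

lemma br_inv_A: "i > 0 \<Longrightarrow> br_inv i \<in> A"
  by (simp add: br_inv_def A_tfrac M_bracket)

lemma br_br_inv: "i > 0 \<Longrightarrow> br i * br_inv i = 1"
  by (simp add: br_inv_def tfrac_mult bracket_nzd non_zero_divisor_1 tfrac_eq_iff flip: tfrac_1)

lemma br_inv_br: "i > 0 \<Longrightarrow> br_inv i * br i = 1"
  using br_br_inv by (simp add: mult.commute)

lemma br_0: "br 0 = 0"
proof -
  have "fgl_bracket F 0 = 0" by (rule fps_ext) (simp add: fgl_bracket_def fgl_mult_def)
  then show ?thesis by (simp add: tfrac_0)
qed

lemma coeff_nabla_poly: "coeff (nabla_poly F p) i = smult (br (Suc i)) (coeff p (Suc i))"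
proof -
  have "coeff (nabla_poly F p) i =
      (\<Sum>l\<le>degree p. if l = Suc i then smult (br l) (coeff p l) else 0)"
    unfolding nabla_poly_def coeff_sum
  proof (rule sum.cong)
    fix l
    show "coeff (monom (smult (br l) (coeff p l)) (l - 1)) i =
        (if l = Suc i then smult (br l) (coeff p l) else 0)"
      using br_0 by (cases l) auto
  qed simp
  also have "\<dots> = smult (br (Suc i)) (coeff p (Suc i))"
    by (auto simp: coeff_eq_0)
  finally show ?thesis .
qed

lemma subst_y_minus_x_eq:
  fixes p :: "'l::comm_ring_1 poly poly"
  assumes "degree p \<le> N"
  shows "subst_y_minus_x p = (\<Sum>i\<le>N. pcompose (coeff p i) [:0, - 1:] * [:0, 1:] ^ i)"
proof -
  let ?q = "map_poly (\<lambda>q. pcompose q [:0, - 1:]) p"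
  have "subst_y_minus_x p = (\<Sum>i\<le>degree ?q. coeff ?q i * [:0, 1:] ^ i)"
    by (simp add: subst_y_minus_x_def poly_altdef)
  also have "\<dots> = (\<Sum>i\<le>N. coeff ?q i * [:0, 1:] ^ i)"
    by (rule sum.mono_neutral_left)
       (use assms map_poly_degree_leq[of "\<lambda>q. pcompose q [:0, - 1:]" p] in \<open>auto simp: coeff_eq_0\<close>)
  finally show ?thesis by (simp add: coeff_map_poly)
qed

lemma subst_y_minus_x_diff:
  "subst_y_minus_x (p - q) = subst_y_minus_x p - subst_y_minus_x q"
  for p q :: "'l::comm_ring_1 poly poly"
proof -
  let ?N = "max (degree p) (degree q)"
  have "degree (p - q) \<le> ?N" by (rule degree_diff_le) auto
  then show ?thesis
    by (simp add: subst_y_minus_x_eq[of _ ?N] pcompose_diff left_diff_distrib sum_subtractf)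
qed

lemma subst_y_minus_x_const: "subst_y_minus_x [:q:] = pcompose q [:0, - 1:]"
  for q :: "'l::comm_ring_1 poly"
  by (subst subst_y_minus_x_eq[of _ 0]) auto

lemma pcompose_minus_minus: "pcompose (pcompose q [:0, - 1:]) [:0, - 1:] = q"
  for q :: "'l::comm_ring_1 poly"
proof -
  have "pcompose [:0, - 1:] [:0, - 1:] = ([:0, 1:] :: 'l poly)" by (simp add: pcompose_pCons)
  then show ?thesis by (metis pcompose_assoc pcompose_idR)
qed

text \<open>By induction the \<open>F\<close>-derivatives of the two polynomials agree. As all
  \<open>\<langle>i\<rangle>\<close> with \<open>i > 0\<close> are invertible, the difference is a polynomial in
  \<open>y\<close> alone, and such a polynomial is determined by its value at \<open>y = -x\<close>.\<close>

lemma binomial_seq_unique: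
  assumes P: "is_binomial_seq F P" and Q: "is_binomial_seq F Q"
  shows "P = Q"
proof
  fix n
  show "P n = Q n"
  proof (induction n)
    case 0
    show ?case using P Q by (simp add: is_binomial_seq_def)
  next
    case (Suc n)
    have "nabla_poly F (P (Suc n)) = nabla_poly F (Q (Suc n))"
      using P Q Suc by (simp add: is_binomial_seq_def)
    then have eq: "smult (br (Suc i)) (coeff (P (Suc n)) (Suc i)) =
        smult (br (Suc i)) (coeff (Q (Suc n)) (Suc i))" for i
      by (simp only: coeff_nabla_poly[symmetric])
    have "coeff (P (Suc n)) (Suc i) = coeff (Q (Suc n)) (Suc i)" for i
      using arg_cong[OF eq[of i], of "smult (br_inv (Suc i))"]
      by (simp only: smult_smult br_inv_br[OF zero_less_Suc] smult_1_left)
    then have const: "P (Suc n) - Q (Suc n) = [:coeff (P (Suc n) - Q (Suc n)) 0:]"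
      by (intro poly_eqI) (auto simp: coeff_pCons split: nat.split)
    have "subst_y_minus_x (P (Suc n) - Q (Suc n)) = 0"
      using P Q by (simp add: is_binomial_seq_def subst_y_minus_x_diff)
    then have "pcompose (coeff (P (Suc n) - Q (Suc n)) 0) [:0, - 1:] = 0"
      by (metis const subst_y_minus_x_const)
    then have "coeff (P (Suc n) - Q (Suc n)) 0 = 0" using pcompose_minus_minus by (metis pcompose_0)
    then show ?case using const by simp
  qed
qed

text \<open>An antiderivative of \<open>\<langle>n\<rangle> p\<close> without constant term.\<close>

definition antideriv :: "nat \<Rightarrow> 'a fps total_fract poly poly \<Rightarrow> 'a fps total_fract poly poly" where
  "antideriv n p = (\<Sum>i\<le>degree p. monom (smult (br n * br_inv (Suc i)) (coeff p i)) (Suc i))"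

lemma coeff_antideriv_Suc: "coeff (antideriv n p) (Suc i) = smult (br n * br_inv (Suc i)) (coeff p i)"
  by (auto simp: antideriv_def coeff_sum coeff_eq_0)

lemma coeff_antideriv_0: "coeff (antideriv n p) 0 = 0"
  by (simp add: antideriv_def coeff_sum)

text \<open>Subtracting a polynomial in \<open>y\<close> makes the antiderivative vanish at \<open>y = -x\<close>, since the
  substitution \<open>y \<mapsto> -y\<close> is an involution.\<close>

primrec binom_poly :: "nat \<Rightarrow> 'a fps total_fract poly poly" where
  "binom_poly 0 = 1"
| "binom_poly (Suc n) = antideriv (Suc n) (binom_poly n) -
    [:pcompose (subst_y_minus_x (antideriv (Suc n) (binom_poly n))) [:0, - 1:]:]"

definition A_poly :: "'a fps total_fract poly set" where
  "A_poly = {q. \<forall>j. coeff q j \<in> A}"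

lemma A_poly_add: "p \<in> A_poly \<Longrightarrow> q \<in> A_poly \<Longrightarrow> p + q \<in> A_poly"
  by (auto simp: A_poly_def A_add)

lemma A_poly_diff: "p \<in> A_poly \<Longrightarrow> q \<in> A_poly \<Longrightarrow> p - q \<in> A_poly"
  using A_add[OF _ A_uminus] by (auto simp: A_poly_def)

lemma A_poly_mult: "p \<in> A_poly \<Longrightarrow> q \<in> A_poly \<Longrightarrow> p * q \<in> A_poly"
  by (auto simp: A_poly_def coeff_mult intro!: A_sum A_mult)

lemma A_poly_0: "0 \<in> A_poly"
  by (simp add: A_poly_def A_0)

lemma A_poly_pCons: "a \<in> A \<Longrightarrow> q \<in> A_poly \<Longrightarrow> pCons a q \<in> A_poly"
  by (auto simp: A_poly_def coeff_pCons split: nat.split)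

lemma A_poly_1: "1 \<in> A_poly"
  unfolding one_pCons by (intro A_poly_pCons A_1 A_poly_0)

lemma A_poly_sum: "(\<And>i. i \<in> I \<Longrightarrow> f i \<in> A_poly) \<Longrightarrow> sum f I \<in> A_poly"
  by (induction I rule: infinite_finite_induct) (auto simp: A_poly_0 A_poly_add)

lemma A_poly_power: "p \<in> A_poly \<Longrightarrow> p ^ n \<in> A_poly"
  by (induction n) (auto simp: A_poly_1 A_poly_mult)

lemma A_poly_pcompose:
  assumes r: "r \<in> A_poly"
  shows "q \<in> A_poly \<Longrightarrow> pcompose q r \<in> A_poly"
proof (induction q)
  case (pCons a q)
  have "a \<in> A" using pCons.prems by (auto simp: A_poly_def dest: spec[of _ 0])
  moreover have "q \<in> A_poly"
  proof -
    have "coeff (pCons a q) (Suc j) \<in> A" for j using pCons.prems unfolding A_poly_def by blast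
    then show ?thesis by (simp add: A_poly_def)
  qed
  ultimately show ?case unfolding pcompose_pCons
    by (intro A_poly_add A_poly_mult A_poly_pCons A_poly_0 r pCons.IH)
qed simp

lemma A_poly_subst:
  assumes "\<And>i. coeff p i \<in> A_poly"
  shows "subst_y_minus_x p \<in> A_poly"
  unfolding subst_y_minus_x_eq[OF order.refl]
  by (intro A_poly_sum A_poly_mult A_poly_pcompose A_poly_power A_poly_pCons A_poly_0 A_0 A_1
      A_minus_1 assms)

lemma binom_poly_A: "coeff (binom_poly n) i \<in> A_poly"
proof (induction n arbitrary: i)
  case 0
  show ?case by (simp add: A_poly_0 A_poly_1)
next
  case (Suc n)
  have J: "coeff (antideriv (Suc n) (binom_poly n)) i \<in> A_poly" for i
  proof (cases i)
    case (Suc l)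
    have "br (Suc n) * br_inv (Suc l) \<in> A" by (intro A_mult br_A br_inv_A) simp
    then show ?thesis using Suc.IH[of l]
      by (auto simp: Suc coeff_antideriv_Suc A_poly_def A_mult)
  qed (simp add: coeff_antideriv_0 A_poly_0)
  have "coeff [:pcompose (subst_y_minus_x (antideriv (Suc n) (binom_poly n))) [:0, - 1:]:] i \<in> A_poly"
    by (cases i) (simp_all add: A_poly_0,
        intro A_poly_pcompose A_poly_subst J A_poly_pCons A_poly_0 A_0 A_minus_1)
  then show ?case by (simp add: A_poly_diff J)
qed

lemma binom_poly_binomial: "is_binomial_seq F binom_poly"
  unfolding is_binomial_seq_def
proof (intro conjI allI impI)
  show "coeff (coeff (binom_poly n) i) j \<in> A" for n i j
    using binom_poly_A by (auto simp: A_poly_def)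
next
  fix n :: nat assume "n > 0"
  then obtain m where n: "n = Suc m" by (cases n) auto
  show "subst_y_minus_x (binom_poly n) = 0"
    by (simp add: n subst_y_minus_x_diff subst_y_minus_x_const pcompose_minus_minus)
  show "nabla_poly F (binom_poly n) = smult [:br n:] (binom_poly (n - 1))"
  proof (rule poly_eqI)
    fix i
    have "br (Suc i) * (br n * br_inv (Suc i)) = br n * (br (Suc i) * br_inv (Suc i))"
      by (simp only: mult_ac)
    also have "\<dots> = br n" by (simp add: br_br_inv del: of_nat_Suc)
    finally show "coeff (nabla_poly F (binom_poly n)) i = coeff (smult [:br n:] (binom_poly (n - 1))) i"
      by (simp add: coeff_nabla_poly n coeff_antideriv_Suc del: of_nat_Suc)
  qed
qed simp

lemma binomial_seq: "is_binomial_seq F (binomial_seq F)"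
  unfolding binomial_seq_def
  by (rule theI[where P = "is_binomial_seq F", OF binom_poly_binomial]) (rule binomial_seq_unique[OF _ binom_poly_binomial])

subsection \<open>The polynomials \<open>(x - 1)\<^sup>n\<^sub>s\<close>\<close>

lemma coeff_twisted_power: "coeff (twisted_power F n) i = poly (coeff (binomial_seq F n) i) (- 1)"
  by (simp add: twisted_power_def coeff_map_poly)

lemma coeff_twisted_power_A: "coeff (twisted_power F n) i \<in> A"
  unfolding coeff_twisted_power poly_altdef
  using binomial_seq by (intro A_sum A_mult A_power A_minus_1) (auto simp: is_binomial_seq_def)

lemma twisted_power_0: "twisted_power F 0 = 1"
  using binomial_seq by (intro poly_eqI) (simp add: coeff_twisted_power is_binomial_seq_def)

lemma twisted_power_nabla:
  "br (Suc i) * coeff (twisted_power F (Suc n)) (Suc i) = br (Suc n) * coeff (twisted_power F n) i"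
proof -
  have "nabla_poly F (binomial_seq F (Suc n)) = smult [:br (Suc n):] (binomial_seq F n)"
    using binomial_seq unfolding is_binomial_seq_def by (metis diff_Suc_1 zero_less_Suc)
  then have "smult (br (Suc i)) (coeff (binomial_seq F (Suc n)) (Suc i)) =
      coeff (smult [:br (Suc n):] (binomial_seq F n)) i"
    by (simp only: coeff_nabla_poly[symmetric])
  then have "poly (smult (br (Suc i)) (coeff (binomial_seq F (Suc n)) (Suc i))) (- 1) =
      poly (coeff (smult [:br (Suc n):] (binomial_seq F n)) i) (- 1)" by (rule arg_cong)
  then show ?thesis by (simp add: coeff_twisted_power del: of_nat_Suc)
qed

text \<open>The sum of the coefficients of \<open>(x-1)\<^sup>n\<^sub>s\<close> is the value of
  \<open>(x+y)\<^sup>n\<^sub>s\<close> at \<open>x = 1\<close>, \<open>y = -1\<close>, which vanishes because \<open>y =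
  -x\<close> there.\<close>

lemma twisted_power_at_1:
  assumes "n > 0" "degree (twisted_power F n) \<le> N"
  shows "(\<Sum>i\<le>N. coeff (twisted_power F n) i) = 0"
proof -
  let ?P = "binomial_seq F n"
  have le: "degree (twisted_power F n) \<le> degree ?P"
    unfolding twisted_power_def by (rule map_poly_degree_leq)
  have "(\<Sum>i\<le>N. coeff (twisted_power F n) i) = (\<Sum>i\<le>degree (twisted_power F n). coeff (twisted_power F n) i)"
    by (rule sum.mono_neutral_right) (use assms in \<open>auto simp: coeff_eq_0\<close>)
  also have "\<dots> = (\<Sum>i\<le>degree ?P. coeff (twisted_power F n) i)"
    by (rule sum.mono_neutral_left) (use le in \<open>auto simp: coeff_eq_0\<close>)
  also have "\<dots> = poly (subst_y_minus_x ?P) 1"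
    by (simp add: subst_y_minus_x_eq[OF order.refl] poly_sum poly_pcompose coeff_twisted_power)
  also have "\<dots> = 0" using binomial_seq assms by (simp add: is_binomial_seq_def)
  finally show ?thesis .
qed

section \<open>The expansion of \<open>F log\<close>\<close>

lemma poly_to_rat_eq:
  assumes "degree p \<le> N"
  shows "poly_to_rat F p = (\<Sum>i\<le>N. fps_const (loc_to_rat F (coeff p i)) * x ^ i)"
  unfolding poly_to_rat_def
  by (rule sum.mono_neutral_left) (use assms in \<open>auto simp: coeff_eq_0 loc_to_rat_0\<close>)

lemma poly_to_rat_smult:
  assumes "z \<in> A" "\<And>i. coeff p i \<in> A"
  shows "poly_to_rat F (smult z p) = fps_const (loc_to_rat F z) * poly_to_rat F p"
  by (subst poly_to_rat_eq[OF degree_smult_le], subst poly_to_rat_eq[OF order.refl])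
     (simp only: coeff_smult loc_to_rat_mult[OF assms] sum_distrib_left fps_const_mult[symmetric] mult.assoc)

definition twisted_rat :: "nat \<Rightarrow> 'a rationalization fps fps" where
  "twisted_rat n = poly_to_rat F (twisted_power F n)"

lemma twisted_rat_0: "twisted_rat 0 = 1"
  by (simp add: twisted_rat_def twisted_power_0 poly_to_rat_def loc_to_rat_1)

text \<open>The outer coefficient of index 0 is the value at \<open>x = 1\<close>.\<close>

lemma twisted_rat_Suc_nth_0: "twisted_rat (Suc n) $ 0 = 0"
  using twisted_power_at_1[of "Suc n" "degree (twisted_power F (Suc n))"]
  by (simp add: twisted_rat_def poly_to_rat_def fps_sum_nth power_nth_0 loc_to_rat_0 coeff_twisted_power_A
      flip: loc_to_rat_sum)

lemma nabla_twisted_rat: "nabla F (twisted_rat (Suc n)) = fps_const (brac (int (Suc n))) * twisted_rat n"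
proof -
  let ?c = "\<lambda>n i. loc_to_rat F (coeff (twisted_power F n) i)"
  define N where "N = max (degree (twisted_power F (Suc n))) (degree (twisted_power F n))"
  have c: "?c (Suc n) (Suc i) * brac (int (Suc i)) = brac (int (Suc n)) * ?c n i" for i
  proof -
    have br: "brac (int k) = loc_to_rat F (br k)" for k by (simp add: brac_def loc_to_rat_tfrac_1)
    show ?thesis
      unfolding br loc_to_rat_mult[OF br_A coeff_twisted_power_A, symmetric]
        loc_to_rat_mult[OF coeff_twisted_power_A br_A, symmetric]
      by (subst mult.commute) (simp only: twisted_power_nabla)
  qed
  have "twisted_rat (Suc n) = (\<Sum>i\<le>Suc N. fps_const (?c (Suc n) i) * x ^ i)"
    unfolding twisted_rat_def by (rule poly_to_rat_eq) (simp add: N_def)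
  then have "nabla F (twisted_rat (Suc n)) =
      (\<Sum>i\<le>Suc N. fps_const (?c (Suc n) i) * (fps_const (brac (int i)) * x ^ (i - 1)))"
    by (simp only: nabla_sum nabla_cmult nabla_x_power)
  also have "\<dots> = (\<Sum>i\<le>N. fps_const (?c (Suc n) (Suc i) * brac (int (Suc i))) * x ^ i)"
    unfolding sum.atMost_Suc_shift
    by (simp only: of_nat_0 brac_0 fps_const_0_eq_0 mult_zero_left mult_zero_right add_0_left
        diff_Suc_1 fps_const_mult[symmetric] mult.assoc)
  also have "\<dots> = fps_const (brac (int (Suc n))) * (\<Sum>i\<le>N. fps_const (?c n i) * x ^ i)"
    by (simp only: c fps_const_mult[symmetric] mult.assoc sum_distrib_left)
  also have "(\<Sum>i\<le>N. fps_const (?c n i) * x ^ i) = twisted_rat n"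
    unfolding twisted_rat_def by (rule poly_to_rat_eq[symmetric]) (simp add: N_def)
  finally show ?thesis .
qed

text \<open>The divided powers \<open>(x - 1)\<^sup>n\<^sub>s / n!\<^sub>F\<close>.\<close>

definition divided_power :: "nat \<Rightarrow> 'a rationalization fps fps" where
  "divided_power n = fps_const (loc_to_rat F (tfrac 1 (fgl_fact F n))) * twisted_rat n"

lemma divided_power_0: "divided_power 0 = 1"
  by (simp add: divided_power_def twisted_rat_0 fgl_fact_def tfrac_1 loc_to_rat_1)

lemma divided_power_nth_0: "divided_power n $ 0 = (if n = 0 then 1 else 0)"
  by (cases n) (simp_all add: divided_power_0, simp add: divided_power_def twisted_rat_Suc_nth_0)

lemma nabla_divided_power_0: "nabla F (divided_power 0) = 0"
  using nabla_x_power[of 0] by (simp add: divided_power_0 brac_0)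

lemma nabla_divided_power_Suc: "nabla F (divided_power (Suc n)) = divided_power n"
proof -
  have fact: "fgl_fact F (Suc n) = fgl_bracket F (int (Suc n)) * fgl_fact F n"
    by (simp add: fgl_fact_def mult.commute)
  have "loc_to_rat F (tfrac 1 (fgl_fact F (Suc n))) * brac (int (Suc n)) * fps_map of_R (fgl_fact F n) =
      loc_to_rat F (tfrac 1 (fgl_fact F (Suc n))) * fps_map of_R (fgl_fact F (Suc n))"
    by (simp only: fact map_R.mult brac_def mult.assoc)
  also have "\<dots> = fps_map of_R 1" by (rule loc_to_rat_mult_denominator[OF M_fact])
  finally have "loc_to_rat F (tfrac 1 (fgl_fact F n)) =
      loc_to_rat F (tfrac 1 (fgl_fact F (Suc n))) * brac (int (Suc n))"
    by (intro loc_to_rat_eqI[OF M_fact])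
  then show ?thesis
    by (simp only: divided_power_def nabla_cmult nabla_twisted_rat fps_const_mult[symmetric] mult.assoc)
qed

lemma nabla_pow_divided_power: "(nabla F ^^ m) (divided_power n) = (if m \<le> n then divided_power (n - m) else 0)"
proof (induction m)
  case (Suc m)
  show ?case
  proof (cases "Suc m \<le> n")
    case True
    then have "n - m = Suc (n - Suc m)" by simp
    with Suc True show ?thesis by (simp add: nabla_divided_power_Suc)
  next
    case False
    with Suc show ?thesis by (cases "m = n") (simp_all add: nabla_divided_power_0 nabla_0)
  qed
qed simp

text \<open>The value of \<open>\<nabla>\<^sup>n F log\<close> at \<open>x = 1\<close>, for \<open>n > 0\<close>.\<close>

definition log_coeff :: "nat \<Rightarrow> 'a rationalization fps" where
  "log_coeff n = (\<Prod>k=1..n-1. brac (- int k))"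

lemma nabla_pow_Flog: "(nabla F ^^ Suc m) (Flog F) = fps_const (log_coeff (Suc m)) * x_inv ^ Suc m"
proof (induction m)
  case 0
  show ?case by (simp add: nabla_Flog log_coeff_def)
next
  case (Suc m)
  have "log_coeff (Suc (Suc m)) = log_coeff (Suc m) * brac (- int (Suc m))"
    by (simp add: log_coeff_def)
  then show ?case
    by (simp only: funpow.simps(2) o_apply Suc[unfolded funpow.simps(2) o_apply] nabla_cmult
        nabla_x_inv_power fps_const_mult[symmetric] mult.assoc)
qed

lemma x_inv_nth_0: "x_inv $ 0 = 1"
proof -
  have "(x * x_inv) $ 0 = 1" by (simp only: x_x_inv) simp
  then show ?thesis by simp
qed

lemma nabla_pow_diff_sum:
  "(nabla F ^^ m) (f - (\<Sum>n\<in>I. fps_const (c n) * g n)) =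
    (nabla F ^^ m) f - (\<Sum>n\<in>I. fps_const (c n) * (nabla F ^^ m) (g n))"
  by (induction m) (simp_all add: nabla_diff nabla_sum nabla_cmult)

text \<open>The iterated derivatives at \<open>x = 1\<close> of the two sides agree up to order \<open>N\<close>; for
  \<open>m = 0\<close> both are 0.\<close>

lemma Flog_taylor: "Flog F - (\<Sum>n=1..N. fps_const (log_coeff n) * divided_power n) \<in> fps2_ideal (Suc N)"
proof (rule taylor_zero)
  fix m assume m: "m \<le> N"
  have "(\<Sum>n=1..N. fps_const (log_coeff n) * (nabla F ^^ m) (divided_power n)) $ 0 =
      (\<Sum>n=1..N. if n = m then log_coeff m else 0)"
    unfolding fps_sum_nth by (rule sum.cong) (auto simp: nabla_pow_divided_power divided_power_nth_0)
  also have "\<dots> = (nabla F ^^ m) (Flog F) $ 0"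
  proof (cases m)
    case 0
    then show ?thesis by (simp add: Flog_nth_0)
  next
    case (Suc l)
    show ?thesis using m
      unfolding Suc nabla_pow_Flog by (simp add: power_nth_0 x_inv_nth_0)
  qed
  finally show "(nabla F ^^ m) (Flog F - (\<Sum>n=1..N. fps_const (log_coeff n) * divided_power n)) $ 0 = 0"
    by (simp add: nabla_pow_diff_sum)
qed

lemma expansion_term:
  "poly_to_rat F
     (smult (tfrac (\<Prod>k=1..n-1. fgl_bracket F (- int k)) (fgl_fact F n)) (twisted_power F n)) =
    fps_const (log_coeff n) * divided_power n"
proof -
  let ?c = "\<Prod>k=1..n-1. fgl_bracket F (- int k)"
  have "tfrac ?c (fgl_fact F n) = tfrac ?c 1 * tfrac 1 (fgl_fact F n)"
    by (simp add: tfrac_mult non_zero_divisor_1 M_nzd M_fact)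
  then have "loc_to_rat F (tfrac ?c (fgl_fact F n)) = log_coeff n * loc_to_rat F (tfrac 1 (fgl_fact F n))"
    by (simp add: loc_to_rat_mult A_tfrac M_1 M_fact loc_to_rat_tfrac_1 log_coeff_def brac_def map_R.prod)
  then show ?thesis
    by (simp add: poly_to_rat_smult A_tfrac M_fact coeff_twisted_power_A divided_power_def twisted_rat_def mult.assoc
        flip: fps_const_mult)
qed

lemma Flog_sums:
  "adic_sums
    (\<lambda>n. poly_to_rat F
       (smult (tfrac (\<Prod>k=1..n-1. fgl_bracket F (- int k)) (fgl_fact F n)) (twisted_power F n)))
    (Flog F)"
  unfolding expansion_term adic_sums_def
proof (intro allI exI impI)
  fix K N i j :: nat assume "K \<le> N" "i + j < K"
  then have "(Flog F - (\<Sum>n=1..N. fps_const (log_coeff n) * divided_power n)) $ i $ j = 0"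
    using Flog_taylor[of N] by (auto simp: fps2_ideal_def)
  then show "(\<Sum>n=1..N. fps_const (log_coeff n) * divided_power n) $ i $ j = Flog F $ i $ j" by simp
qed

end

theorem corollary4p3p15:
  fixes F :: "'a::comm_ring_1 fps fps"
  assumes "formal_group_law F"
    and "\<And>n. n > 0 \<Longrightarrow> non_zero_divisor (fgl_mult F n)"
  shows "nabla F (Flog F) = unit_inv (1 + fps_X) \<and>
    fps_at2 (Flog F) (var_x * var_y) = fps_at2 (Flog F) var_x + fps_at2 (Flog F) var_y \<and>
    adic_sums
      (\<lambda>n. poly_to_rat F
         (smult (tfrac (\<Prod>k=1..n-1. fgl_bracket F (- int k)) (fgl_fact F n)) (twisted_power F n)))
      (Flog F)"
proof -
  interpret R: fgl F by (rule formal_group_law_fgl[OF assms(1)])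
  interpret torsion_free_fgl F by unfold_locales (rule assms(2))
  show ?thesis using nabla_Flog Flog_mult Flog_sums by blast
qed

end
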